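(* Let $X$ be a Banach space, $(x_n)_{n\in\omega}$ an $L$-orthogonal sequence in $X$, and $\mu:\mathcal P(\omega)\to[0,1]$ a strong $Q$-measure with $\mu(\omega)=1$. Then $\mu\text{-}\lim x_n$ is an $L$-orthogonal element of $X^{**}$.
   Context: Measures are finitely additive and vanish on finite sets. $\mu$ is a strong $Q$-measure if for every partition $\{A_n\}$ of $\omega$ into finite sets there is $A\subseteq\omega$ with $\mu(A)\ge\mu(\omega)$ and $|A\cap A_n|\le1$ for all $n$. A sequence $(x_n)\subseteq B_X$ is $L$-orthogonal if $\lim_n\|x+x_n\|=1+\|x\|$ for all $x\in X$; $x^{**}\in X^{**}$ is $L$-orthogonal if $\|x+x^{**}\|=1+\|x\|$ for all $x\in X$. Let $T:\ell_1\to X$ be the bounded operator with $T(e_n)=x_n$. Identifying $\ell_1^{**}=\ell_\infty^*$ with the space of finitely additive signed measures of bounded variation on $\mathcal P(\omega)$, define $\mu\text{-}\lim x_n:=T^{**}(\mu)\in X^{**}$. *)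

theory Defs
  imports "HOL-Analysis.Analysis" "HOL-Library.Disjoint_Sets"
begin

section \<open>Finitely additive measures on the subsets of the natural numbers\<close>

definition finitely_additive :: "(nat set \<Rightarrow> real) \<Rightarrow> bool" where
  "finitely_additive \<mu> \<longleftrightarrow> (\<forall>A B. A \<inter> B = {} \<longrightarrow> \<mu> (A \<union> B) = \<mu> A + \<mu> B)"

definition bounded_variation :: "(nat set \<Rightarrow> real) \<Rightarrow> bool" where
  "bounded_variation \<mu> \<longleftrightarrow>
     (\<exists>C. \<forall>P. finite P \<and> partition_on UNIV P \<longrightarrow> (\<Sum>A\<in>P. \<bar>\<mu> A\<bar>) \<le> C)"

text \<open>Values are constrained to an interval separately, by the user of the definition.\<close>

definition fa_measure :: "(nat set \<Rightarrow> real) \<Rightarrow> bool" where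
  "fa_measure \<mu> \<longleftrightarrow> finitely_additive \<mu> \<and> (\<forall>A. finite A \<longrightarrow> \<mu> A = 0)"

definition strong_Q_measure :: "(nat set \<Rightarrow> real) \<Rightarrow> bool" where
  "strong_Q_measure \<mu> \<longleftrightarrow> fa_measure \<mu> \<and>
     (\<forall>P. partition_on UNIV P \<and> (\<forall>p\<in>P. finite p) \<longrightarrow>
        (\<exists>A. \<mu> A \<ge> \<mu> UNIV \<and> (\<forall>p\<in>P. card (A \<inter> p) \<le> 1)))"


section \<open>Duals, adjoints and L-orthogonality\<close>

type_synonym 'a dual = "'a \<Rightarrow>\<^sub>L real"

definition dual_map ::
  "('a::real_normed_vector \<Rightarrow>\<^sub>L 'b::real_normed_vector) \<Rightarrow> ('b dual \<Rightarrow>\<^sub>L 'a dual)" where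
  "dual_map T = Blinfun (\<lambda>f. f o\<^sub>L T)"

lemma dual_map_apply: "blinfun_apply (dual_map T) f = f o\<^sub>L T"
  unfolding dual_map_def
  by (simp add: bounded_linear_Blinfun_apply
      bounded_bilinear.bounded_linear_left[OF bounded_bilinear_blinfun_compose])

definition bidual_embed :: "'a::real_normed_vector \<Rightarrow> 'a dual dual" where
  "bidual_embed x = Blinfun (\<lambda>f. blinfun_apply f x)"

lemma bidual_embed_apply: "blinfun_apply (bidual_embed x) f = blinfun_apply f x"
  unfolding bidual_embed_def
  by (simp add: bounded_linear_Blinfun_apply
      bounded_bilinear.bounded_linear_left[OF bounded_bilinear_blinfun_apply])

definition L_orthogonal_seq :: "(nat \<Rightarrow> 'a::real_normed_vector) \<Rightarrow> bool" where
  "L_orthogonal_seq x \<longleftrightarrow> (\<forall>n. x n \<in> cball 0 1) \<and>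
     (\<forall>y. (\<lambda>n. norm (y + x n)) \<longlonglongrightarrow> 1 + norm y)"

definition L_orthogonal_bidual :: "('a::real_normed_vector) dual dual \<Rightarrow> bool" where
  "L_orthogonal_bidual z \<longleftrightarrow> (\<forall>y. norm (bidual_embed y + z) = 1 + norm y)"


section \<open>The space of absolutely summable sequences\<close>

typedef l1 = "{a :: nat \<Rightarrow> real. summable (\<lambda>n. \<bar>a n\<bar>)}"
  morphisms l1_nth Abs_l1
  by (rule exI[of _ "\<lambda>_. 0"]) simp

setup_lifting type_definition_l1

lemma l1_summable_abs: "summable (\<lambda>n. \<bar>l1_nth a n\<bar>)"
  using l1_nth[of a] by simp

instantiation l1 :: real_vector
begin

lift_definition zero_l1 :: l1 is "\<lambda>_. 0" by simp

lift_definition plus_l1 :: "l1 \<Rightarrow> l1 \<Rightarrow> l1" is "\<lambda>a b n. a n + b n"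
proof -
  fix a b :: "nat \<Rightarrow> real"
  assume "summable (\<lambda>n. \<bar>a n\<bar>)" "summable (\<lambda>n. \<bar>b n\<bar>)"
  then have "summable (\<lambda>n. \<bar>a n\<bar> + \<bar>b n\<bar>)" by (rule summable_add)
  then show "summable (\<lambda>n. \<bar>a n + b n\<bar>)"
    by (rule summable_comparison_test'[of _ 0]) simp
qed

lift_definition uminus_l1 :: "l1 \<Rightarrow> l1" is "\<lambda>a n. - a n" by simp

lift_definition minus_l1 :: "l1 \<Rightarrow> l1 \<Rightarrow> l1" is "\<lambda>a b n. a n - b n"
proof -
  fix a b :: "nat \<Rightarrow> real"
  assume "summable (\<lambda>n. \<bar>a n\<bar>)" "summable (\<lambda>n. \<bar>b n\<bar>)"
  then have "summable (\<lambda>n. \<bar>a n\<bar> + \<bar>b n\<bar>)" by (rule summable_add)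
  then show "summable (\<lambda>n. \<bar>a n - b n\<bar>)"
    by (rule summable_comparison_test'[of _ 0]) simp
qed

lift_definition scaleR_l1 :: "real \<Rightarrow> l1 \<Rightarrow> l1" is "\<lambda>c a n. c * a n"
  by (simp add: abs_mult summable_mult)

instance
  by standard (transfer; simp add: fun_eq_iff algebra_simps)+

end

instantiation l1 :: real_normed_vector
begin

definition norm_l1 :: "l1 \<Rightarrow> real" where
  "norm_l1 a = (\<Sum>n. \<bar>l1_nth a n\<bar>)"

definition sgn_l1 :: "l1 \<Rightarrow> l1" where
  "sgn_l1 a = a /\<^sub>R norm a"

definition dist_l1 :: "l1 \<Rightarrow> l1 \<Rightarrow> real" where
  "dist_l1 a b = norm (a - b)"

definition uniformity_l1 :: "(l1 \<times> l1) filter" where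
  "uniformity_l1 = (INF e\<in>{0<..}. principal {(a, b). dist a b < e})"

definition open_l1 :: "l1 set \<Rightarrow> bool" where
  "open_l1 U = (\<forall>a\<in>U. \<forall>\<^sub>F (a', b) in uniformity. a' = a \<longrightarrow> b \<in> U)"

instance
proof
  fix a b :: l1 and c :: real
  show "dist a b = norm (a - b)" by (rule dist_l1_def)
  show "sgn a = a /\<^sub>R norm a" by (rule sgn_l1_def)
  show "uniformity = (INF e\<in>{0<..}. principal {(a, b::l1). dist a b < e})"
    by (rule uniformity_l1_def)
  show "open U = (\<forall>a\<in>U. \<forall>\<^sub>F (a', b) in uniformity. a' = a \<longrightarrow> b \<in> U)" for U :: "l1 set"
    by (rule open_l1_def)
  show "(norm a = 0) = (a = 0)"
    unfolding norm_l1_def using suminf_eq_zero_iff[OF l1_summable_abs[of a]]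
    by (simp add: l1_nth_inject[symmetric] zero_l1.rep_eq fun_eq_iff)
  show "norm (a + b) \<le> norm a + norm b"
    unfolding norm_l1_def suminf_add[OF l1_summable_abs l1_summable_abs]
    by (rule suminf_le[OF _ l1_summable_abs summable_add[OF l1_summable_abs l1_summable_abs]])
      (simp add: plus_l1.rep_eq)
  show "norm (c *\<^sub>R a) = \<bar>c\<bar> * norm a"
    unfolding norm_l1_def
    by (simp add: scaleR_l1.rep_eq abs_mult suminf_mult[OF l1_summable_abs])
qed

end

lift_definition l1_unit :: "nat \<Rightarrow> l1" is "\<lambda>n k. if k = n then 1 else 0"
proof -
  fix n :: nat
  show "summable (\<lambda>k. \<bar>if k = n then 1 else 0 :: real\<bar>)"
    by (rule summable_finite[of "{n}"]) auto
qed

lemma norm_l1_unit: "norm (l1_unit n) = 1"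
proof -
  have "norm (l1_unit n) = (\<Sum>k\<in>{n}. \<bar>l1_nth (l1_unit n) k\<bar>)"
    unfolding norm_l1_def by (rule suminf_finite) (auto simp: l1_unit.rep_eq)
  then show ?thesis by (simp add: l1_unit.rep_eq)
qed

lemma l1_nth_sum: "finite I \<Longrightarrow> l1_nth (\<Sum>i\<in>I. f i) n = (\<Sum>i\<in>I. l1_nth (f i) n)"
  by (induction I rule: finite_induct) (simp_all add: zero_l1.rep_eq plus_l1.rep_eq)

lemma l1_unit_sums: "(\<lambda>n. l1_nth a n *\<^sub>R l1_unit n) sums a"
  unfolding sums_def
proof (rule LIM_zero_cancel, rule tendsto_norm_zero_cancel)
  let ?d = "\<lambda>N. (\<Sum>n<N. l1_nth a n *\<^sub>R l1_unit n) - a"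
  have nth: "l1_nth (?d N) k = (if k < N then 0 else - l1_nth a k)" for N k
  proof -
    have "(\<Sum>n<N. l1_nth a n * (if k = n then 1 else 0)) = (if k < N then l1_nth a k else 0)"
      by (simp add: if_distrib[of "\<lambda>c. _ * c"] cong: if_cong)
    then show ?thesis
      by (simp add: minus_l1.rep_eq l1_nth_sum scaleR_l1.rep_eq l1_unit.rep_eq)
  qed
  have "norm (?d N) = (\<Sum>k. \<bar>l1_nth a (k + N)\<bar>)" for N
  proof -
    have "norm (?d N) = (\<Sum>k. \<bar>l1_nth (?d N) (k + N)\<bar>) + (\<Sum>k<N. \<bar>l1_nth (?d N) k\<bar>)"
      unfolding norm_l1_def by (rule suminf_split_initial_segment[OF l1_summable_abs])
    then show ?thesis by (simp add: nth)
  qed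
  then have eq: "(\<lambda>N. norm (?d N)) = (\<lambda>N. \<Sum>k. \<bar>l1_nth a (k + N)\<bar>)" by blast
  show "(\<lambda>N. norm (?d N)) \<longlonglongrightarrow> 0"
    unfolding eq by (rule suminf_exist_split2[OF l1_summable_abs])
qed

lemma l1_blinfun_eqI:
  fixes S T :: "l1 \<Rightarrow>\<^sub>L 'a::real_normed_vector"
  assumes "\<And>n. blinfun_apply S (l1_unit n) = blinfun_apply T (l1_unit n)"
  shows "S = T"
proof (rule blinfun_eqI)
  fix a
  have "(\<lambda>n. blinfun_apply R (l1_nth a n *\<^sub>R l1_unit n)) sums blinfun_apply R a"
    for R :: "l1 \<Rightarrow>\<^sub>L 'a"
    by (rule bounded_linear.sums[OF blinfun.bounded_linear_right l1_unit_sums])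
  from this[of S] this[of T] show "blinfun_apply S a = blinfun_apply T a"
    by (simp add: blinfun.scaleR_right assms sums_unique2)
qed

lemma l1_operator_exists:
  fixes x :: "nat \<Rightarrow> 'a::banach"
  assumes "\<And>n. norm (x n) \<le> C"
  shows "\<exists>T :: l1 \<Rightarrow>\<^sub>L 'a. (\<forall>n. blinfun_apply T (l1_unit n) = x n) \<and> norm T \<le> C"
proof -
  let ?T = "\<lambda>a. \<Sum>n. l1_nth a n *\<^sub>R x n"
  have "C \<ge> 0" using assms[of 0] norm_ge_zero[of "x 0"] by linarith
  have bd: "norm (l1_nth a n *\<^sub>R x n) \<le> C * \<bar>l1_nth a n\<bar>" for a n
    using mult_right_mono[OF assms, of "\<bar>l1_nth a n\<bar>" n] by (simp add: mult.commute)
  have sC: "summable (\<lambda>n. C * \<bar>l1_nth a n\<bar>)" for a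
    by (rule summable_mult[OF l1_summable_abs])
  have sn: "summable (\<lambda>n. norm (l1_nth a n *\<^sub>R x n))" for a
    by (rule summable_comparison_test'[OF sC[of a], of 0]) (use bd in simp)
  note s = summable_norm_cancel[OF sn]
  have bnd: "norm (?T a) \<le> norm a * C" for a
  proof -
    have "norm (?T a) \<le> (\<Sum>n. norm (l1_nth a n *\<^sub>R x n))" by (rule summable_norm[OF sn])
    also have "\<dots> \<le> (\<Sum>n. C * \<bar>l1_nth a n\<bar>)" by (rule suminf_le[OF bd sn sC])
    also have "\<dots> = norm a * C"
      by (simp add: norm_l1_def suminf_mult[OF l1_summable_abs] mult.commute)
    finally show ?thesis .
  qed
  have bl: "bounded_linear ?T"
  proof (rule bounded_linear_intro[OF _ _ bnd])
    show "?T (a + b) = ?T a + ?T b" for a b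
      by (simp add: plus_l1.rep_eq scaleR_add_left suminf_add[OF s s])
    show "?T (c *\<^sub>R a) = c *\<^sub>R ?T a" for c a
      using suminf_scaleR_right[OF s, of c a] by (simp add: scaleR_l1.rep_eq)
  qed
  have "?T (l1_unit n) = x n" for n
    using suminf_finite[of "{n}" "\<lambda>k. l1_nth (l1_unit n) k *\<^sub>R x k"] by (simp add: l1_unit.rep_eq)
  moreover have "norm (Blinfun ?T) \<le> C"
    by (rule norm_blinfun_bound[OF \<open>C \<ge> 0\<close>])
      (use bnd bl in \<open>simp add: bounded_linear_Blinfun_apply mult.commute\<close>)
  ultimately show ?thesis
    by (intro exI[of _ "Blinfun ?T"]) (simp add: bounded_linear_Blinfun_apply[OF bl])
qed

definition l1_operator :: "(nat \<Rightarrow> 'a::banach) \<Rightarrow> (l1 \<Rightarrow>\<^sub>L 'a)" where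
  "l1_operator x = (THE T. \<forall>n. blinfun_apply T (l1_unit n) = x n)"

lemma l1_operator:
  fixes x :: "nat \<Rightarrow> 'a::banach"
  assumes "\<And>n. norm (x n) \<le> C"
  shows "blinfun_apply (l1_operator x) (l1_unit n) = x n" and "norm (l1_operator x) \<le> C"
proof -
  obtain T :: "l1 \<Rightarrow>\<^sub>L 'a"
    where T: "\<forall>n. blinfun_apply T (l1_unit n) = x n" "norm T \<le> C"
    using l1_operator_exists[of x C, OF assms] by blast
  have "l1_operator x = T"
    unfolding l1_operator_def
  proof (rule the_equality)
    show "\<forall>n. blinfun_apply T (l1_unit n) = x n" by (rule T(1))
    show "S = T" if "\<forall>n. blinfun_apply S (l1_unit n) = x n" for S
      by (rule l1_blinfun_eqI) (simp add: that T(1))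
  qed
  with T show "blinfun_apply (l1_operator x) (l1_unit n) = x n" "norm (l1_operator x) \<le> C"
    by simp_all
qed


section \<open>The bidual of the absolutely summable sequences as a space of measures\<close>

text \<open>A bounded sequence \<open>f\<close> corresponds to the functional on \<^typ>\<open>l1\<close> taking the value
  \<open>f n\<close> at the \<open>n\<close>-th unit vector.\<close>

abbreviation linf_dual :: "(nat \<Rightarrow> real) \<Rightarrow> l1 dual" where
  "linf_dual f \<equiv> l1_operator f"

lemma linf_dual_apply:
  assumes "\<And>n. \<bar>f n\<bar> \<le> C"
  shows "(\<lambda>n. f n * l1_nth a n) sums blinfun_apply (linf_dual f) a"
proof -
  have "blinfun_apply (linf_dual f) (l1_unit n) = f n" for n
    by (rule l1_operator(1)[of f C]) (simp add: assms)
  then show ?thesis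
    using bounded_linear.sums[OF blinfun.bounded_linear_right l1_unit_sums, of "linf_dual f" a]
    by (simp add: blinfun.scaleR_right mult.commute)
qed

lemma linf_dual_coeffs: "linf_dual (\<lambda>n. blinfun_apply \<psi> (l1_unit n)) = \<psi>"
proof (rule l1_blinfun_eqI, rule l1_operator(1))
  show "norm (blinfun_apply \<psi> (l1_unit n)) \<le> norm \<psi>" for n
    using norm_blinfun[of \<psi> "l1_unit n"] by (simp add: norm_l1_unit)
qed

text \<open>The functional on \<^typ>\<open>l1 dual\<close> (that is, on the bounded sequences) identified with \<open>\<mu>\<close>
  is the bounded functional whose value at the indicator of each set \<open>A\<close> is \<open>\<mu> A\<close>.\<close>

definition ba_functional :: "(nat set \<Rightarrow> real) \<Rightarrow> l1 dual dual" where
  "ba_functional \<mu> = (THE \<phi>. \<forall>A. blinfun_apply \<phi> (linf_dual (indicator A)) = \<mu> A)"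

definition mu_lim :: "(nat set \<Rightarrow> real) \<Rightarrow> (nat \<Rightarrow> 'a::banach) \<Rightarrow> 'a dual dual" where
  "mu_lim \<mu> x = blinfun_apply (dual_map (dual_map (l1_operator x))) (ba_functional \<mu>)"


subsection \<open>The description of the functional of a measure is legitimate\<close>

lemma linf_dual_bounded_linear_combination:
  assumes "\<And>n. \<bar>f n\<bar> \<le> C" "\<And>n. \<bar>g n\<bar> \<le> D"
  shows "linf_dual (\<lambda>n. c * f n + d * g n) = c *\<^sub>R linf_dual f + d *\<^sub>R linf_dual g"
proof (rule l1_blinfun_eqI)
  fix n
  have "norm (c * f k + d * g k) \<le> \<bar>c\<bar> * C + \<bar>d\<bar> * D" for k
  proof -
    have "\<bar>c * f k\<bar> \<le> \<bar>c\<bar> * C" "\<bar>d * g k\<bar> \<le> \<bar>d\<bar> * D"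
      using assms by (simp_all add: abs_mult mult_left_mono)
    then show ?thesis by simp
  qed
  from l1_operator(1)[of "\<lambda>n. c * f n + d * g n", OF this]
    l1_operator(1)[of f C] l1_operator(1)[of g D] assms
  show "blinfun_apply (linf_dual (\<lambda>n. c * f n + d * g n)) (l1_unit n)
      = blinfun_apply (c *\<^sub>R linf_dual f + d *\<^sub>R linf_dual g) (l1_unit n)"
    by (simp add: blinfun.add_left blinfun.scaleR_left)
qed

lemma finitely_additive_empty: "finitely_additive \<mu> \<Longrightarrow> \<mu> {} = 0"
  unfolding finitely_additive_def by (metis Int_empty_left Un_empty_left add_cancel_right_right)

lemma finitely_additive_UN:
  assumes "finitely_additive \<mu>" "finite I" "disjoint_family_on A I"
  shows "\<mu> (\<Union>i\<in>I. A i) = (\<Sum>i\<in>I. \<mu> (A i))"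
  using assms(2,3)
proof (induction I rule: finite_induct)
  case empty
  then show ?case by (simp add: finitely_additive_empty[OF assms(1)])
next
  case (insert i I)
  then have "disjoint_family_on A I" "A i \<inter> (\<Union>j\<in>I. A j) = {}"
    by (auto simp: disjoint_family_on_def)
  with insert show ?case using assms(1) by (simp add: finitely_additive_def)
qed

definition simple_integral_fa :: "(nat set \<Rightarrow> real) \<Rightarrow> (nat \<Rightarrow> real) \<Rightarrow> real" where
  "simple_integral_fa \<mu> f = (\<Sum>y\<in>range f. y * \<mu> (f -` {y}))"

lemma simple_integral_fa_comp:
  fixes h :: "nat \<Rightarrow> 'b"
  assumes fa: "finitely_additive \<mu>" and fin: "finite (range h)"
  shows "simple_integral_fa \<mu> (\<lambda>n. u (h n)) = (\<Sum>z\<in>range h. u z * \<mu> (h -` {z}))"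
proof -
  have "(\<Sum>z\<in>range h. u z * \<mu> (h -` {z}))
      = (\<Sum>y\<in>u ` range h. \<Sum>z\<in>{z\<in>range h. u z = y}. u z * \<mu> (h -` {z}))"
    by (rule sum.image_gen[OF fin])
  also have "\<dots> = (\<Sum>y\<in>u ` range h. y * \<mu> ((\<lambda>n. u (h n)) -` {y}))"
  proof (rule sum.cong[OF refl])
    fix y
    let ?I = "{z\<in>range h. u z = y}"
    have "(\<lambda>n. u (h n)) -` {y} = (\<Union>z\<in>?I. h -` {z})" by auto
    moreover have "\<mu> (\<Union>z\<in>?I. h -` {z}) = (\<Sum>z\<in>?I. \<mu> (h -` {z}))"
      by (rule finitely_additive_UN[OF fa]) (auto simp: fin disjoint_family_on_def)
    ultimately show "(\<Sum>z\<in>?I. u z * \<mu> (h -` {z})) = y * \<mu> ((\<lambda>n. u (h n)) -` {y})"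
      by (simp add: sum_distrib_left)
  qed
  also have "\<dots> = simple_integral_fa \<mu> (\<lambda>n. u (h n))"
    unfolding simple_integral_fa_def by (simp add: image_image)
  finally show ?thesis by simp
qed

lemma finite_range_Pair: "finite (range f) \<Longrightarrow> finite (range g) \<Longrightarrow> finite (range (\<lambda>n. (f n, g n)))"
  by (rule finite_subset[of _ "range f \<times> range g"]) auto

lemma simple_integral_fa_linear:
  assumes "finitely_additive \<mu>" "finite (range f)" "finite (range g)"
  shows "simple_integral_fa \<mu> (\<lambda>n. c * f n + d * g n)
       = c * simple_integral_fa \<mu> f + d * simple_integral_fa \<mu> g"
proof -
  note * = simple_integral_fa_comp[OF assms(1) finite_range_Pair[OF assms(2,3)]]
  show ?thesis
    using *[of "\<lambda>z. c * fst z + d * snd z"] *[of fst] *[of snd]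
    by (simp add: algebra_simps sum.distrib sum_distrib_left)
qed

lemma simple_integral_fa_bound:
  assumes C: "\<And>P. finite P \<Longrightarrow> partition_on UNIV P \<Longrightarrow> (\<Sum>A\<in>P. \<bar>\<mu> A\<bar>) \<le> C"
    and fin: "finite (range f)" and B: "\<And>n. \<bar>f n\<bar> \<le> B"
  shows "\<bar>simple_integral_fa \<mu> f\<bar> \<le> B * C"
proof -
  have "B \<ge> 0" using B[of 0] by linarith
  have "\<bar>simple_integral_fa \<mu> f\<bar> \<le> (\<Sum>y\<in>range f. \<bar>y * \<mu> (f -` {y})\<bar>)"
    unfolding simple_integral_fa_def by (rule sum_abs)
  also have "\<dots> \<le> (\<Sum>y\<in>range f. B * \<bar>\<mu> (f -` {y})\<bar>)"
    by (rule sum_mono) (use B in \<open>auto simp: abs_mult intro: mult_right_mono\<close>)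
  also have "\<dots> = B * (\<Sum>A\<in>(\<lambda>y. f -` {y}) ` range f. \<bar>\<mu> A\<bar>)"
  proof -
    have "inj_on (\<lambda>y. f -` {y}) (range f)" by (rule inj_onI) blast
    then show ?thesis by (simp add: sum.reindex sum_distrib_left)
  qed
  also have "\<dots> \<le> B * C"
  proof (rule mult_left_mono[OF C \<open>B \<ge> 0\<close>])
    show "finite ((\<lambda>y. f -` {y}) ` range f)" using fin by simp
    show "partition_on UNIV ((\<lambda>y. f -` {y}) ` range f)"
      by (rule partition_onI) (auto simp: disjnt_def)
  qed
  finally show ?thesis .
qed

definition grid_approx :: "nat \<Rightarrow> (nat \<Rightarrow> real) \<Rightarrow> nat \<Rightarrow> real" where
  "grid_approx k f n = \<lfloor>real (Suc k) * f n\<rfloor> / real (Suc k)"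

lemma grid_approx_error: "\<bar>f n - grid_approx k f n\<bar> \<le> 1 / real (Suc k)"
proof -
  let ?s = "real (Suc k)"
  have "\<bar>?s * f n - \<lfloor>?s * f n\<rfloor>\<bar> \<le> 1" by linarith
  then have "\<bar>(?s * f n - \<lfloor>?s * f n\<rfloor>) / ?s\<bar> \<le> 1 / ?s"
    by (simp add: divide_right_mono)
  then show ?thesis unfolding grid_approx_def by (simp add: diff_divide_distrib)
qed

lemma finite_range_grid_approx:
  assumes B: "\<And>n. \<bar>f n\<bar> \<le> B"
  shows "finite (range (grid_approx k f))"
proof -
  let ?s = "real (Suc k)"
  have "\<lfloor>?s * f n\<rfloor> \<in> {\<lfloor>- (?s * B)\<rfloor>..\<lfloor>?s * B\<rfloor>}" for n
  proof -
    have "\<bar>?s * f n\<bar> \<le> ?s * B"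
      using B[of n] unfolding abs_mult by (intro mult_mono) auto
    then have "- (?s * B) \<le> ?s * f n" "?s * f n \<le> ?s * B" by linarith+
    then show ?thesis by (simp add: floor_mono)
  qed
  then have "range (grid_approx k f) \<subseteq> (\<lambda>j. of_int j / ?s) ` {\<lfloor>- (?s * B)\<rfloor>..\<lfloor>?s * B\<rfloor>}"
    unfolding grid_approx_def by blast
  then show ?thesis by (rule finite_subset) simp
qed

lemma ba_functional_unique:
  fixes \<phi> \<phi>' :: "l1 dual dual"
  assumes eq: "\<And>A. blinfun_apply \<phi> (linf_dual (indicator A)) = blinfun_apply \<phi>' (linf_dual (indicator A))"
  shows "\<phi> = \<phi>'"
proof (rule blinfun_eqI)
  fix \<psi> :: "l1 dual"
  define f where "f n = blinfun_apply \<psi> (l1_unit n)" for n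
  define \<delta> where "\<delta> = \<phi> - \<phi>'"
  have f_bd: "\<bar>f n\<bar> \<le> norm \<psi>" for n
    unfolding f_def using norm_blinfun[of \<psi> "l1_unit n"] by (simp add: norm_l1_unit)
  have \<psi>: "\<psi> = linf_dual f" unfolding f_def by (simp add: linf_dual_coeffs)
  have ind: "blinfun_apply \<delta> (linf_dual (indicator A)) = 0" for A
    unfolding \<delta>_def using eq by (simp add: blinfun.diff_left)
  have comb: "blinfun_apply \<delta> (linf_dual (\<lambda>n. \<Sum>y\<in>Y. y * indicator (g -` {y}) n)) = 0 \<and>
      (\<forall>n. \<bar>\<Sum>y\<in>Y. y * indicator (g -` {y}) n\<bar> \<le> (\<Sum>y\<in>Y. \<bar>y\<bar>))"
    if "finite Y" for Y :: "real set" and g :: "nat \<Rightarrow> real"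
    using that
  proof (induction Y rule: finite_induct)
    case empty
    have "linf_dual (\<lambda>n. 0) = 0"
      using linf_dual_bounded_linear_combination[of "\<lambda>_. 0" 0 "\<lambda>_. 0" 0 0 0] by simp
    then show ?case by (simp add: blinfun.zero_right)
  next
    case (insert y Y)
    let ?i = "indicator (g -` {y}) :: nat \<Rightarrow> real"
    let ?r = "\<lambda>n. \<Sum>y\<in>Y. y * indicator (g -` {y}) n"
    have "\<bar>?i n\<bar> \<le> 1" for n by (simp add: indicator_def)
    from linf_dual_bounded_linear_combination[of ?i 1 ?r "\<Sum>y\<in>Y. \<bar>y\<bar>" y 1, OF this] insert
    have "linf_dual (\<lambda>n. y * ?i n + ?r n) = y *\<^sub>R linf_dual ?i + linf_dual ?r" by simp
    then have "blinfun_apply \<delta> (linf_dual (\<lambda>n. y * ?i n + ?r n)) = 0"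
      using insert ind by (simp add: blinfun.add_right blinfun.scaleR_right)
    moreover have "\<bar>y * ?i n + ?r n\<bar> \<le> \<bar>y\<bar> + (\<Sum>y\<in>Y. \<bar>y\<bar>)" for n
    proof -
      have "\<bar>y * ?i n\<bar> \<le> \<bar>y\<bar>" by (simp add: indicator_def)
      moreover have "\<bar>?r n\<bar> \<le> (\<Sum>y\<in>Y. \<bar>y\<bar>)" using insert.IH by blast
      ultimately show ?thesis by linarith
    qed
    ultimately show ?case unfolding sum.insert[OF insert.hyps] by blast
  qed
  have simple: "blinfun_apply \<delta> (linf_dual g) = 0" if "finite (range g)" for g
  proof -
    have "g n = (\<Sum>y\<in>range g. y * indicator (g -` {y}) n)" for n
    proof -
      have "(\<Sum>y\<in>range g. y * indicator (g -` {y}) n) = (\<Sum>y\<in>range g. if g n = y then y else 0)"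
        by (rule sum.cong) (auto simp: indicator_def)
      also have "\<dots> = g n" using that by (simp add: sum.delta')
      finally show ?thesis by simp
    qed
    then have "linf_dual g = linf_dual (\<lambda>n. \<Sum>y\<in>range g. y * indicator (g -` {y}) n)"
      by metis
    then show ?thesis using comb[OF that, of g] by simp
  qed
  have small: "\<bar>blinfun_apply \<delta> \<psi>\<bar> \<le> norm \<delta> * (1 / real (Suc k))" for k
  proof -
    let ?g = "grid_approx k f"
    have g_bd: "\<bar>?g n\<bar> \<le> norm \<psi> + 1 / real (Suc k)" for n
      using f_bd[of n] grid_approx_error[of f n k] by linarith
    have "linf_dual (\<lambda>n. f n - ?g n) = \<psi> - linf_dual ?g"
      unfolding \<psi> using linf_dual_bounded_linear_combination[of f _ ?g _ 1 "-1", OF f_bd g_bd]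
      by simp
    then have "blinfun_apply \<delta> \<psi> = blinfun_apply \<delta> (linf_dual (\<lambda>n. f n - ?g n))"
      using simple[OF finite_range_grid_approx, OF f_bd] by (simp add: blinfun.diff_right)
    also have "\<bar>\<dots>\<bar> \<le> norm \<delta> * norm (linf_dual (\<lambda>n. f n - ?g n))"
      using norm_blinfun[of \<delta> "linf_dual (\<lambda>n. f n - ?g n)"] by simp
    also have "\<dots> \<le> norm \<delta> * (1 / real (Suc k))"
      by (intro mult_left_mono l1_operator(2)) (use grid_approx_error in \<open>simp_all del: of_nat_Suc\<close>)
    finally show ?thesis .
  qed
  have "(\<lambda>k. norm \<delta> * (1 / real (Suc k))) \<longlonglongrightarrow> norm \<delta> * 0"
    by (intro tendsto_mult tendsto_const LIMSEQ_Suc[OF lim_1_over_n])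
  then have "\<bar>blinfun_apply \<delta> \<psi>\<bar> \<le> norm \<delta> * 0"
    by (rule LIMSEQ_le_const) (use small in blast)
  then show "blinfun_apply \<phi> \<psi> = blinfun_apply \<phi>' \<psi>"
    unfolding \<delta>_def by (simp add: blinfun.diff_left)
qed

lemma ba_functional_exists:
  assumes fa: "finitely_additive \<mu>"
    and C: "\<And>P. finite P \<Longrightarrow> partition_on UNIV P \<Longrightarrow> (\<Sum>A\<in>P. \<bar>\<mu> A\<bar>) \<le> C"
  shows "\<exists>\<phi> :: l1 dual dual. (\<forall>A. blinfun_apply \<phi> (linf_dual (indicator A)) = \<mu> A) \<and> norm \<phi> \<le> C"
proof -
  let ?S = "simple_integral_fa \<mu>"
  define I where "I f = lim (\<lambda>k. ?S (grid_approx k f))" for f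
  have "partition_on UNIV {UNIV :: nat set}" by (rule partition_onI) auto
  then have C0: "C \<ge> 0" using C[of "{UNIV}"] by simp
  have S_diff: "\<bar>?S f - ?S g\<bar> \<le> e * C"
    if "finite (range f)" "finite (range g)" "\<And>n. \<bar>f n - g n\<bar> \<le> e" for f g e
  proof -
    have "finite (range (\<lambda>n. f n - g n))"
      using finite_imageI[OF finite_range_Pair[OF that(1,2)], of "\<lambda>(a, b). a - b"]
      by (simp add: image_image)
    from simple_integral_fa_bound[of \<mu> C, OF C this that(3)]
    show ?thesis using simple_integral_fa_linear[OF fa that(1,2), of 1 "-1"] by simp
  qed
  have lim0: "(\<lambda>k. (1 / real (Suc k)) * C) \<longlonglongrightarrow> 0 * C"
    by (intro tendsto_mult tendsto_const LIMSEQ_Suc[OF lim_1_over_n])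
  have I_lim: "(\<lambda>k. ?S (grid_approx k f)) \<longlonglongrightarrow> I f" if B: "\<And>n. \<bar>f n\<bar> \<le> B" for f B
  proof -
    have d: "\<bar>?S (grid_approx k f) - ?S (grid_approx l f)\<bar>
        \<le> (1 / real (Suc k)) * C + (1 / real (Suc l)) * C" for k l
    proof -
      have "\<bar>grid_approx k f n - grid_approx l f n\<bar> \<le> 1 / real (Suc k) + 1 / real (Suc l)" for n
        using grid_approx_error[of f n k] grid_approx_error[of f n l] by linarith
      from S_diff[OF finite_range_grid_approx finite_range_grid_approx, OF B B this]
      show ?thesis by (simp add: distrib_right)
    qed
    have "Cauchy (\<lambda>k. ?S (grid_approx k f))"
    proof (rule metric_CauchyI)
      fix e :: real assume "e > 0"
      then have "\<forall>\<^sub>F k in sequentially. (1 / real (Suc k)) * C < e / 2"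
        using order_tendstoD(2)[OF lim0, of "e / 2"] by simp
      then obtain N where N: "\<And>k. k \<ge> N \<Longrightarrow> (1 / real (Suc k)) * C < e / 2"
        unfolding eventually_sequentially by blast
      show "\<exists>M. \<forall>m\<ge>M. \<forall>n\<ge>M. dist (?S (grid_approx m f)) (?S (grid_approx n f)) < e"
      proof (intro exI[of _ N] allI impI)
        fix m n assume "N \<le> m" "N \<le> n"
        then show "dist (?S (grid_approx m f)) (?S (grid_approx n f)) < e"
          using d[of m n] N[of m] N[of n] unfolding dist_real_def by linarith
      qed
    qed
    then show ?thesis
      unfolding I_def by (simp add: Cauchy_convergent_iff convergent_LIMSEQ_iff)
  qed
  have I_approx: "\<bar>I f - ?S g\<bar> \<le> e * C"
    if B: "\<And>n. \<bar>f n\<bar> \<le> B" and g: "finite (range g)" and e: "\<And>n. \<bar>f n - g n\<bar> \<le> e" for f g B e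
  proof (rule LIMSEQ_le)
    show "(\<lambda>k. \<bar>?S (grid_approx k f) - ?S g\<bar>) \<longlonglongrightarrow> \<bar>I f - ?S g\<bar>"
      by (intro tendsto_intros I_lim[OF B])
    show "(\<lambda>k. (1 / real (Suc k)) * C + e * C) \<longlonglongrightarrow> e * C"
      using tendsto_add[OF lim0 tendsto_const[of "e * C"]] by simp
    have "\<bar>?S (grid_approx k f) - ?S g\<bar> \<le> (1 / real (Suc k)) * C + e * C" for k
    proof -
      have "\<bar>grid_approx k f n - g n\<bar> \<le> 1 / real (Suc k) + e" for n
        using grid_approx_error[of f n k] e[of n] by linarith
      from S_diff[OF finite_range_grid_approx, OF B g this] show ?thesis
        by (simp add: distrib_right)
    qed
    then show "\<exists>N. \<forall>k\<ge>N. \<bar>?S (grid_approx k f) - ?S g\<bar> \<le> (1 / real (Suc k)) * C + e * C"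
      by blast
  qed
  have I_bound: "\<bar>I f\<bar> \<le> B * C" if B: "\<And>n. \<bar>f n\<bar> \<le> B" for f B
  proof -
    have "?S (\<lambda>_. 0) = 0" by (simp add: simple_integral_fa_def)
    then show ?thesis using I_approx[of f B "\<lambda>_. 0" B] B by simp
  qed
  have I_lin: "I (\<lambda>n. c * f n + d * g n) = c * I f + d * I g"
    if B: "\<And>n. \<bar>f n\<bar> \<le> B" and D: "\<And>n. \<bar>g n\<bar> \<le> D" for c d f g B D
  proof -
    let ?h = "\<lambda>n. c * f n + d * g n"
    let ?s = "\<lambda>k n. c * grid_approx k f n + d * grid_approx k g n"
    have mult_bd: "\<bar>c * a + d * b\<bar> \<le> \<bar>c\<bar> * a' + \<bar>d\<bar> * b'" if "\<bar>a\<bar> \<le> a'" "\<bar>b\<bar> \<le> b'" for a b a' b'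
    proof -
      have "\<bar>c * a\<bar> \<le> \<bar>c\<bar> * a'" "\<bar>d * b\<bar> \<le> \<bar>d\<bar> * b'"
        using that by (simp_all add: abs_mult mult_left_mono)
      then show ?thesis by linarith
    qed
    have bd: "\<bar>I ?h - ?S (?s k)\<bar> \<le> (\<bar>c\<bar> + \<bar>d\<bar>) * ((1 / real (Suc k)) * C)" for k
    proof -
      have fin: "finite (range (?s k))"
        using finite_imageI[OF finite_range_Pair[OF finite_range_grid_approx[of f B k]
            finite_range_grid_approx[of g D k], OF B D], of "\<lambda>(a, b). c * a + d * b"]
        by (simp add: image_image)
      have err: "\<bar>?h n - ?s k n\<bar> \<le> \<bar>c\<bar> * (1 / real (Suc k)) + \<bar>d\<bar> * (1 / real (Suc k))" for n
        using mult_bd[OF grid_approx_error[of f n k] grid_approx_error[of g n k]]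
        by (simp add: algebra_simps)
      have "\<bar>?h n\<bar> \<le> \<bar>c\<bar> * B + \<bar>d\<bar> * D" for n by (rule mult_bd[OF B D])
      from I_approx[OF this fin err] show ?thesis by (simp add: algebra_simps add_divide_distrib)
    qed
    have "(\<lambda>k. I ?h - ?S (?s k)) \<longlonglongrightarrow> 0"
    proof (rule Lim_null_comparison)
      show "\<forall>\<^sub>F k in sequentially. norm (I ?h - ?S (?s k)) \<le> (\<bar>c\<bar> + \<bar>d\<bar>) * ((1 / real (Suc k)) * C)"
        using bd by (simp del: of_nat_Suc)
      show "(\<lambda>k. (\<bar>c\<bar> + \<bar>d\<bar>) * ((1 / real (Suc k)) * C)) \<longlonglongrightarrow> 0"
        using tendsto_mult[OF tendsto_const[of "\<bar>c\<bar> + \<bar>d\<bar>"] lim0] by simp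
    qed
    moreover have "?S (?s k) = c * ?S (grid_approx k f) + d * ?S (grid_approx k g)" for k
      by (rule simple_integral_fa_linear[OF fa finite_range_grid_approx finite_range_grid_approx, OF B D])
    ultimately have "(\<lambda>k. I ?h - (c * ?S (grid_approx k f) + d * ?S (grid_approx k g))) \<longlonglongrightarrow> 0"
      by simp
    moreover have "(\<lambda>k. I ?h - (c * ?S (grid_approx k f) + d * ?S (grid_approx k g)))
        \<longlonglongrightarrow> I ?h - (c * I f + d * I g)"
      by (intro tendsto_intros I_lim[OF B] I_lim[OF D])
    ultimately show ?thesis using LIMSEQ_unique by fastforce
  qed
  define F where "F \<psi> = I (\<lambda>n. blinfun_apply \<psi> (l1_unit n))" for \<psi> :: "l1 dual"
  have co: "\<bar>blinfun_apply \<psi> (l1_unit n)\<bar> \<le> norm \<psi>" for \<psi> :: "l1 dual" and n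
    using norm_blinfun[of \<psi> "l1_unit n"] by (simp add: norm_l1_unit)
  have F_bd: "norm (F \<psi>) \<le> norm \<psi> * C" for \<psi>
    unfolding F_def using I_bound[OF co] by simp
  have F_bl: "bounded_linear F"
  proof (rule bounded_linear_intro[OF _ _ F_bd])
    show "F (\<psi> + \<psi>') = F \<psi> + F \<psi>'" for \<psi> \<psi>'
      unfolding F_def using I_lin[OF co[of \<psi>] co[of \<psi>'], where c = 1 and d = 1] by (simp add: blinfun.add_left)
    show "F (c *\<^sub>R \<psi>) = c *\<^sub>R F \<psi>" for c \<psi>
      unfolding F_def using I_lin[OF co[of \<psi>] co[of \<psi>], where c = c and d = 0] by (simp add: blinfun.scaleR_left)
  qed
  have "F (linf_dual (indicator A)) = \<mu> A" for A
  proof -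
    have i: "\<bar>indicator A n :: real\<bar> \<le> 1" for n by (simp add: indicator_def)
    have fin: "finite (range (indicator A :: nat \<Rightarrow> real))"
      by (rule finite_subset[of _ "{0, 1}"]) (auto simp: indicator_def)
    have "F (linf_dual (indicator A)) = I (indicator A)"
      unfolding F_def using l1_operator(1)[of "indicator A :: nat \<Rightarrow> real" 1] i by simp
    also have "\<dots> = ?S (indicator A)"
      using I_approx[OF i fin, where e = 0] by simp
    also have "\<dots> = ?S (\<lambda>n. of_bool (n \<in> A))"
      by (rule arg_cong[of _ _ ?S]) (auto simp: indicator_def)
    also have "\<dots> = (\<Sum>z\<in>range (\<lambda>n. n \<in> A). of_bool z * \<mu> ((\<lambda>n. n \<in> A) -` {z}))"
      by (rule simple_integral_fa_comp[OF fa]) simp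
    also have "\<dots> = (\<Sum>z\<in>UNIV. of_bool z * \<mu> ((\<lambda>n. n \<in> A) -` {z}))"
    proof (rule sum.mono_neutral_left)
      show "\<forall>z\<in>UNIV - range (\<lambda>n. n \<in> A). of_bool z * \<mu> ((\<lambda>n. n \<in> A) -` {z}) = 0"
      proof
        fix z assume "z \<in> UNIV - range (\<lambda>n. n \<in> A)"
        then have "(\<lambda>n. n \<in> A) -` {z} = {}" by auto
        then show "of_bool z * \<mu> ((\<lambda>n. n \<in> A) -` {z}) = 0"
          by (simp add: finitely_additive_empty[OF fa])
      qed
    qed auto
    also have "\<dots> = \<mu> A" by (simp add: UNIV_bool vimage_def)
    finally show ?thesis .
  qed
  moreover have "norm (Blinfun F) \<le> C"
    by (rule norm_blinfun_bound[OF C0])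
      (use F_bd F_bl in \<open>simp add: bounded_linear_Blinfun_apply mult.commute\<close>)
  ultimately show ?thesis
    by (intro exI[of _ "Blinfun F"]) (simp add: bounded_linear_Blinfun_apply[OF F_bl])
qed

lemma ba_functional_exists1:
  assumes "finitely_additive \<mu>" "bounded_variation \<mu>"
  shows "\<exists>!\<phi>. \<forall>A. blinfun_apply \<phi> (linf_dual (indicator A)) = \<mu> A"
proof -
  obtain C where "\<And>P. finite P \<Longrightarrow> partition_on UNIV P \<Longrightarrow> (\<Sum>A\<in>P. \<bar>\<mu> A\<bar>) \<le> C"
    using assms(2) unfolding bounded_variation_def by blast
  then obtain \<phi> :: "l1 dual dual"
    where \<phi>: "\<forall>A. blinfun_apply \<phi> (linf_dual (indicator A)) = \<mu> A"
    using ba_functional_exists[OF assms(1)] by blast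
  show ?thesis
  proof (rule ex1I)
    show "\<forall>A. blinfun_apply \<phi> (linf_dual (indicator A)) = \<mu> A" by (rule \<phi>)
    show "\<phi>' = \<phi>" if "\<forall>A. blinfun_apply \<phi>' (linf_dual (indicator A)) = \<mu> A" for \<phi>'
      by (rule ba_functional_unique) (simp add: that \<phi>)
  qed
qed

lemma ba_functional:
  assumes "finitely_additive \<mu>" "bounded_variation \<mu>"
  shows "blinfun_apply (ba_functional \<mu>) (linf_dual (indicator A)) = \<mu> A"
  using theI'[OF ba_functional_exists1[OF assms]] unfolding ba_functional_def by blast

lemma bounded_variation_nonneg:
  assumes fa: "finitely_additive \<mu>" and nonneg: "\<And>A. 0 \<le> \<mu> A"
  shows "bounded_variation \<mu>"
  unfolding bounded_variation_def
proof (intro exI[of _ "\<mu> UNIV"] allI impI)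
  fix P :: "nat set set"
  assume P: "finite P \<and> partition_on UNIV P"
  then have "disjoint_family_on (\<lambda>A. A) P" "\<Union>P = UNIV"
    by (auto simp: partition_on_def disjoint_family_on_def disjoint_def)
  with P finitely_additive_UN[OF fa, of P "\<lambda>A. A"] nonneg
  show "(\<Sum>A\<in>P. \<bar>\<mu> A\<bar>) \<le> \<mu> UNIV" by simp
qed

end

theory Submission
  imports Defs
begin

text \<open>Given \<open>y\<close> and \<open>e > 0\<close>, the strong \<open>Q\<close>-property yields a set \<open>A\<close> of full measure so sparse that
  each \<open>x m\<close> with \<open>m \<in> A\<close> is almost \<open>L\<close>-orthogonal, uniformly by compactness, to the convex hull
  of \<open>y\<close> and the earlier \<open>x n\<close>, with errors summing to \<open>e\<close>. Hence the norm is almost additive on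
  the cone generated by \<open>y\<close> and the \<open>x n\<close>, \<open>n \<in> A\<close>, and the Mazur--Orlicz theorem provides a
  functional \<open>f\<close> in the dual unit ball that is at least \<open>norm y - e\<close> at \<open>y\<close> and at least \<open>1 - e\<close>
  at every \<open>x n\<close>, \<open>n \<in> A\<close>. Evaluating at \<open>f\<close> bounds the norm in the bidual from below by
  \<open>1 + norm y - 2 * e\<close>.\<close>

section \<open>Sublinear functionals\<close>

text \<open>Homogeneity is required only as an inequality, the form in which it passes to infima;
  \<open>sublinear_scaleR\<close> recovers equality.\<close>

definition sublinear :: "('a::real_vector \<Rightarrow> real) \<Rightarrow> bool" where
  "sublinear q \<longleftrightarrow> (\<forall>u v. q (u + v) \<le> q u + q v) \<and> (\<forall>c\<ge>0. \<forall>u. q (c *\<^sub>R u) \<le> c * q u)"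

lemma sublinearI:
  assumes "\<And>u v. q (u + v) \<le> q u + q v" and "\<And>c u. 0 \<le> c \<Longrightarrow> q (c *\<^sub>R u) \<le> c * q u"
  shows "sublinear q"
  using assms by (simp add: sublinear_def)

lemma sublinear_add: "sublinear q \<Longrightarrow> q (u + v) \<le> q u + q v"
  by (simp add: sublinear_def)

lemma sublinear_zero:
  assumes "sublinear q"
  shows "q 0 = 0"
proof -
  have "q (0 *\<^sub>R 0) \<le> 0 * q 0" using assms unfolding sublinear_def by blast
  then show ?thesis using sublinear_add[OF assms, of 0 0] by simp
qed

lemma sublinear_scaleR:
  assumes "sublinear q" "0 \<le> c"
  shows "q (c *\<^sub>R u) = c * q u"
proof (cases "c = 0")
  case True
  then show ?thesis by (simp add: sublinear_zero[OF assms(1)])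
next
  case False
  with assms have "c > 0" "inverse c \<ge> 0" by simp_all
  then have "q (inverse c *\<^sub>R c *\<^sub>R u) \<le> inverse c * q (c *\<^sub>R u)"
    using assms unfolding sublinear_def by blast
  with \<open>c > 0\<close> have "c * q u \<le> q (c *\<^sub>R u)" by (simp add: field_simps)
  then show ?thesis using assms by (simp add: sublinear_def order_antisym)
qed

lemma sublinear_minus_ge: "sublinear q \<Longrightarrow> - q (- v) \<le> q v"
  using sublinear_add[of q v "- v"] sublinear_zero[of q] by simp

lemma sublinear_norm: "sublinear norm"
  by (rule sublinearI) (simp_all add: norm_triangle_ineq)

text \<open>Serves infima over chains and also over cones, where a single \<open>r j\<close> need
  not be sublinear; hence \<open>k\<close> may depend on the vectors and the scalar.\<close>

lemma sublinear_INF: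
  fixes r :: "'j \<Rightarrow> 'a::real_vector \<Rightarrow> real"
  assumes ne: "J \<noteq> {}" and bdd: "\<And>v. bdd_below ((\<lambda>j. r j v) ` J)"
    and add: "\<And>i j u v. i \<in> J \<Longrightarrow> j \<in> J \<Longrightarrow> \<exists>k\<in>J. r k (u + v) \<le> r i u + r j v"
    and scale: "\<And>i c u. i \<in> J \<Longrightarrow> 0 \<le> c \<Longrightarrow> \<exists>k\<in>J. r k (c *\<^sub>R u) \<le> c * r i u"
  shows "sublinear (\<lambda>v. INF j\<in>J. r j v)"
proof (rule sublinearI)
  let ?q = "\<lambda>v. INF j\<in>J. r j v"
  have low: "?q v \<le> r j v" if "j \<in> J" for j v by (rule cINF_lower[OF bdd that])
  fix u v
  have "?q (u + v) - r i u \<le> ?q v" if i: "i \<in> J" for i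
  proof (rule cINF_greatest[OF ne])
    fix j assume "j \<in> J"
    with add[OF i this, of u v] obtain k where "k \<in> J" "r k (u + v) \<le> r i u + r j v" by blast
    with low[of k "u + v"] show "?q (u + v) - r i u \<le> r j v" by linarith
  qed
  then have "?q (u + v) - ?q v \<le> r i u" if "i \<in> J" for i
    using that by (simp add: algebra_simps)
  then have "?q (u + v) - ?q v \<le> ?q u" by (rule cINF_greatest[OF ne])
  then show "?q (u + v) \<le> ?q u + ?q v" by simp
next
  let ?q = "\<lambda>v. INF j\<in>J. r j v"
  fix c :: real and u assume c: "0 \<le> c"
  have le: "?q (c *\<^sub>R u) \<le> c * r i u" if i: "i \<in> J" for i
  proof -
    obtain k where "k \<in> J" "r k (c *\<^sub>R u) \<le> c * r i u" using scale[OF i c] by blast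
    with cINF_lower[OF bdd, of k "c *\<^sub>R u"] show ?thesis by linarith
  qed
  show "?q (c *\<^sub>R u) \<le> c * ?q u"
  proof (cases "c = 0")
    case True
    with ne le show ?thesis by auto
  next
    case False
    with c have "c > 0" by simp
    then have "?q (c *\<^sub>R u) / c \<le> ?q u"
      by (intro cINF_greatest[OF ne]) (use le in \<open>simp add: field_simps\<close>)
    with \<open>c > 0\<close> show ?thesis by (simp add: field_simps)
  qed
qed

text \<open>Every linear functional below the resulting \<open>r\<close> is at least \<open>c\<close> at \<open>w\<close>, for each pair
  \<open>(w, c)\<close> of the cone \<open>K\<close>.\<close>

lemma sublinear_below_cone:
  fixes q :: "'a::real_vector \<Rightarrow> real"
  assumes q: "sublinear q" and K: "convex_cone K" and Kq: "\<forall>w c. (w, c) \<in> K \<longrightarrow> c \<le> q w"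
  shows "\<exists>r. sublinear r \<and> r \<le> q \<and> (\<forall>w c. (w, c) \<in> K \<longrightarrow> r (- w) \<le> - c) \<and>
    (\<forall>v b. (\<forall>w c. (w, c) \<in> K \<longrightarrow> b \<le> q (v + w) - c) \<longrightarrow> b \<le> r v)"
proof -
  define r where "r v = (INF (w, c)\<in>K. q (v + w) - c)" for v
  have K0: "(0, 0) \<in> K" using K convex_cone_contains_0[of K] by (simp add: zero_prod_def)
  have bdd: "bdd_below ((\<lambda>(w, c). q (v + w) - c) ` K)" for v
  proof (rule bdd_belowI2)
    fix j assume "j \<in> K"
    \<comment> \<open>Combine \<open>c \<le> q w\<close> on \<open>K\<close> with
      \<open>q w \<le> q (v + w) + q (- v)\<close>.\<close>
    then show "- q (- v) \<le> (case j of (w, c) \<Rightarrow> q (v + w) - c)"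
      using Kq[rule_format, of "fst j" "snd j"] sublinear_add[OF q, of "v + fst j" "- v"] by (auto simp: case_prod_beta)
  qed
  have low: "r v \<le> q (v + w) - c" if "(w, c) \<in> K" for v w c
    unfolding r_def using cINF_lower[OF bdd that] by simp
  have "b \<le> r v" if "\<forall>w c. (w, c) \<in> K \<longrightarrow> b \<le> q (v + w) - c" for v b
    unfolding r_def by (rule cINF_greatest) (use K0 that in auto)
  moreover have "r \<le> q" using low[OF K0] by (simp add: le_fun_def)
  moreover have "r (- w) \<le> - c" if "(w, c) \<in> K" for w c
    using low[OF that, of "- w"] sublinear_zero[OF q] by simp
  moreover have "sublinear (\<lambda>v. INF j\<in>K. case j of (w, c) \<Rightarrow> q (v + w) - c)"
  proof (rule sublinear_INF[OF _ bdd])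
    show "K \<noteq> {}" using K0 by blast
  next
    fix i j u v assume "i \<in> K" "j \<in> K"
    then have "i + j \<in> K" by (rule convex_cone_add[OF K])
    moreover have "q (u + v + (fst i + fst j)) \<le> q (u + fst i) + q (v + fst j)"
      using sublinear_add[OF q, of "u + fst i" "v + fst j"] by (simp add: algebra_simps)
    ultimately show "\<exists>k\<in>K. (case k of (w, c) \<Rightarrow> q (u + v + w) - c)
        \<le> (case i of (w, c) \<Rightarrow> q (u + w) - c) + (case j of (w, c) \<Rightarrow> q (v + w) - c)"
      by (intro bexI[of _ "i + j"]) (simp_all add: case_prod_beta)
  next
    fix i u and c :: real assume "i \<in> K" "0 \<le> c"
    then have "c *\<^sub>R i \<in> K" using convex_cone_scaleR[OF K] by blast
    moreover have "q (c *\<^sub>R u + c *\<^sub>R fst i) = c * q (u + fst i)"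
      using sublinear_scaleR[OF q \<open>0 \<le> c\<close>, of "u + fst i"] by (simp add: algebra_simps)
    ultimately show "\<exists>k\<in>K. (case k of (w, d) \<Rightarrow> q (c *\<^sub>R u + w) - d)
        \<le> c * (case i of (w, d) \<Rightarrow> q (u + w) - d)"
      by (intro bexI[of _ "c *\<^sub>R i"]) (simp_all add: case_prod_beta algebra_simps)
  qed
  then have "sublinear r" by (simp add: r_def[abs_def])
  ultimately show ?thesis by blast
qed

text \<open>The cone is the ray through \<open>(u, b)\<close>. Taking \<open>b = q u\<close> will
  show that minimal functionals are odd; taking \<open>u = y\<close> and
  \<open>b = norm y - e\<close> prescribes the value at \<open>y\<close> before Mazur--Orlicz is
  applied, and the last clause transfers lower estimates to \<open>r\<close>.\<close>

lemma sublinear_below_direction: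
  fixes q :: "'a::real_vector \<Rightarrow> real"
  assumes q: "sublinear q" and b: "b \<le> q u"
  shows "\<exists>r. sublinear r \<and> r \<le> q \<and> r (- u) \<le> - b \<and>
    (\<forall>v d. (\<forall>t\<ge>0. d \<le> q (v + t *\<^sub>R u) - t * b) \<longrightarrow> d \<le> r v)"
proof -
  let ?K = "{(t *\<^sub>R u, t * b) | t. 0 \<le> t}"
  have K: "convex_cone ?K" unfolding convex_cone_iff
  proof safe
    fix s t :: real assume "0 \<le> s" "0 \<le> t"
    then show "\<exists>r. (s *\<^sub>R u, s * b) + (t *\<^sub>R u, t * b) = (r *\<^sub>R u, r * b) \<and> 0 \<le> r"
      by (intro exI[of _ "s + t"]) (simp add: algebra_simps)
    show "\<exists>r. s *\<^sub>R (t *\<^sub>R u, t * b) = (r *\<^sub>R u, r * b) \<and> 0 \<le> r"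
      using \<open>0 \<le> s\<close> \<open>0 \<le> t\<close> by (intro exI[of _ "s * t"]) simp
  qed (auto simp: zero_prod_def)
  have "\<forall>w c. (w, c) \<in> ?K \<longrightarrow> c \<le> q w"
    using b sublinear_scaleR[OF q] by (auto intro: mult_left_mono)
  from sublinear_below_cone[OF q K this] obtain r where r: "sublinear r" "r \<le> q"
    "\<forall>w c. (w, c) \<in> ?K \<longrightarrow> r (- w) \<le> - c"
    "\<forall>v d. (\<forall>w c. (w, c) \<in> ?K \<longrightarrow> d \<le> q (v + w) - c) \<longrightarrow> d \<le> r v"
    by (elim exE conjE) (rule that)
  have "(u, b) \<in> ?K" by (auto intro: exI[of _ 1])
  with r(3) have "r (- u) \<le> - b" by blast
  moreover have "d \<le> r v" if "\<forall>t\<ge>0. d \<le> q (v + t *\<^sub>R u) - t * b" for v d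
    by (rule r(4)[rule_format]) (use that in auto)
  ultimately show ?thesis using r(1,2) by blast
qed

section \<open>Minimal sublinear functionals and the Mazur--Orlicz theorem\<close>

lemma minimal_sublinear:
  fixes p :: "'a::real_vector \<Rightarrow> real"
  assumes p: "sublinear p"
  obtains q where "sublinear q" "q \<le> p" "\<And>r. sublinear r \<Longrightarrow> r \<le> q \<Longrightarrow> r = q"
proof -
  let ?A = "{q. sublinear q \<and> q \<le> p}"
  \<comment> \<open>Zorn's lemma for the reversed pointwise order; a nonempty chain is bounded by
    its pointwise infimum.\<close>
  have "\<exists>m\<in>?A. \<forall>a\<in>?A. m \<ge> a \<longrightarrow> a = m"
  proof (rule predicate_Zorn)
    show "partial_order_on ?A (relation_of (\<lambda>f g. f \<ge> g) ?A)"
      by (rule partial_order_on_relation_ofI) auto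
  next
    fix C assume "C \<in> Chains (relation_of (\<lambda>f g. f \<ge> g) ?A)"
    then have C: "\<And>f. f \<in> C \<Longrightarrow> sublinear f \<and> f \<le> p" "\<And>f g. f \<in> C \<Longrightarrow> g \<in> C \<Longrightarrow> f \<le> g \<or> g \<le> f"
      by (auto simp: Chains_def relation_of_def)
    show "\<exists>u\<in>?A. \<forall>a\<in>C. u \<le> a"
    proof (cases "C = {}")
      case True
      with p show ?thesis by auto
    next
      case False
      let ?u = "\<lambda>v. INF f\<in>C. f v"
      have bdd: "bdd_below ((\<lambda>f. f v) ` C)" for v
      proof (rule bdd_belowI2)
        fix f assume "f \<in> C"
        \<comment> \<open>From \<open>f \<le> p\<close> and sublinearity,
          \<open>- p (- v) \<le> - f (- v) \<le> f v\<close>, so the infimum is a real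
          number.\<close>
        then show "- p (- v) \<le> f v"
          using C(1)[of f] sublinear_minus_ge[of f v] le_funD[of f p "- v"] by linarith
      qed
      have "sublinear ?u"
      proof (rule sublinear_INF[OF False bdd])
        fix f g u v assume fg: "f \<in> C" "g \<in> C"
        define h where "h = (if f \<le> g then f else g)"
        have "h \<in> C" "h \<le> f" "h \<le> g" using fg C(2) by (auto simp: h_def)
        then have "h (u + v) \<le> f u + g v"
          using C(1)[of h] sublinear_add[of h u v] le_funD[of h f u] le_funD[of h g v] by linarith
        with \<open>h \<in> C\<close> show "\<exists>k\<in>C. k (u + v) \<le> f u + g v" by blast
      next
        fix f u and c :: real assume "f \<in> C" "0 \<le> c"
        then show "\<exists>k\<in>C. k (c *\<^sub>R u) \<le> c * f u"
          using C(1)[of f] sublinear_scaleR[of f c u] by (intro bexI[of _ f]) auto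
      qed
      moreover have low: "\<forall>a\<in>C. ?u \<le> a"
        using cINF_lower[OF bdd] by (simp add: le_fun_def)
      moreover have "?u \<le> p"
        using False low C(1) by (meson all_not_in_conv order_trans)
      ultimately show ?thesis by (intro bexI[of _ ?u]) simp_all
    qed
  qed
  then obtain q where q: "sublinear q" "q \<le> p" "\<forall>r. sublinear r \<and> r \<le> p \<longrightarrow> r \<le> q \<longrightarrow> r = q"
    by (simp only: mem_Collect_eq Ball_def Bex_def) (elim exE conjE)
  show ?thesis
  proof (rule that[OF q(1,2)])
    show "r = q" if "sublinear r" "r \<le> q" for r
      using q that order_trans[OF that(2) q(2)] by blast
  qed
qed

text \<open>Lowering \<open>q\<close> along the ray through \<open>(u, q u)\<close> gives some
  \<open>r \<le> q\<close> with \<open>r (- u) \<le> - q u\<close>. Minimality makes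
  \<open>r = q\<close>, so \<open>q\<close> is odd, and an odd sublinear functional is
  linear.\<close>

lemma minimal_sublinear_linear:
  fixes q :: "'a::real_vector \<Rightarrow> real"
  assumes q: "sublinear q" and min: "\<And>r. sublinear r \<Longrightarrow> r \<le> q \<Longrightarrow> r = q"
  shows "linear q"
proof -
  have neg: "q (- u) = - q u" for u
  proof -
    obtain r where "sublinear r" "r \<le> q" "r (- u) \<le> - q u"
      using sublinear_below_direction[OF q order_refl, of u] by blast
    with min[of r] sublinear_minus_ge[OF q, of "- u"] show ?thesis by simp
  qed
  show ?thesis
  proof (rule linearI)
    fix u v
    show "q (u + v) = q u + q v"
      using sublinear_add[OF q, of u v] sublinear_add[OF q, of "- u" "- v"] neg[of "u + v"] neg[of u] neg[of v]
      by simp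
  next
    fix c u
    show "q (c *\<^sub>R u) = c *\<^sub>R q u"
      using sublinear_scaleR[OF q, of c u] sublinear_scaleR[OF q, of "- c" u] neg[of "c *\<^sub>R u"]
      by (cases "0 \<le> c") simp_all
  qed
qed

text \<open>The hypothesis says that the cone generated by the pairs \<open>(v i, b i)\<close> lies
  below the graph of \<open>p\<close>. A minimal sublinear functional below the resulting
  \<open>r\<close> is linear, and its upper bound at \<open>- v i\<close> becomes the lower bound at
  \<open>v i\<close>.\<close>

theorem Mazur_Orlicz:
  fixes p :: "'a::real_vector \<Rightarrow> real" and v :: "'i \<Rightarrow> 'a"
  assumes p: "sublinear p"
    and le: "\<And>D a. finite D \<Longrightarrow> D \<subseteq> I \<Longrightarrow> (\<And>i. 0 \<le> a i)
      \<Longrightarrow> (\<Sum>i\<in>D. a i * b i) \<le> p (\<Sum>i\<in>D. a i *\<^sub>R v i)"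
  obtains f where "linear f" "f \<le> p" "\<And>i. i \<in> I \<Longrightarrow> b i \<le> f (v i)"
proof -
  let ?g = "\<lambda>D a. (\<Sum>i\<in>D. a i *\<^sub>R v i, \<Sum>i\<in>D. a i * b i)"
  let ?K = "{?g D a | D a. finite D \<and> D \<subseteq> I \<and> (\<forall>i. 0 \<le> a i)}"
  have mem: "?g D a \<in> ?K" if "finite D" "D \<subseteq> I" "\<And>i. 0 \<le> a i" for D a
    using that by blast
  have K: "convex_cone ?K" unfolding convex_cone_iff
  proof (intro conjI ballI allI impI)
    show "0 \<in> ?K" using mem[of "{}" "\<lambda>_. 0"] by (simp add: zero_prod_def)
  next
    fix w z assume "w \<in> ?K" "z \<in> ?K"
    then obtain D a E c where w: "w = ?g D a" "finite D" "D \<subseteq> I" "\<forall>i. 0 \<le> a i"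
      and z: "z = ?g E c" "finite E" "E \<subseteq> I" "\<forall>i. 0 \<le> c i"
      by blast
    \<comment> \<open>Extending both coefficient families by zero to \<open>D \<union> E\<close>
      lets the combinations be added termwise.\<close>
    let ?a = "\<lambda>i. if i \<in> D then a i else 0" and ?c = "\<lambda>i. if i \<in> E then c i else 0"
    have "?g D a = ?g (D \<union> E) ?a" "?g E c = ?g (D \<union> E) ?c"
      using w(2) z(2) by (auto intro!: sum.mono_neutral_cong_left)
    then have "w + z = ?g (D \<union> E) (\<lambda>i. ?a i + ?c i)"
      by (simp only: w z add_Pair sum.distrib[symmetric] scaleR_add_left distrib_right)
    also have "\<dots> \<in> ?K" by (rule mem) (use w z in auto)
    finally show "w + z \<in> ?K" .
  next
    fix w and c :: real assume "w \<in> ?K" "0 \<le> c"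
    then obtain D a where w: "w = ?g D a" "finite D" "D \<subseteq> I" "\<forall>i. 0 \<le> a i" by blast
    have "c *\<^sub>R w = ?g D (\<lambda>i. c * a i)"
      by (simp add: w scaleR_sum_right sum_distrib_left mult.assoc)
    also have "\<dots> \<in> ?K" by (rule mem) (use w \<open>0 \<le> c\<close> in auto)
    finally show "c *\<^sub>R w \<in> ?K" .
  qed
  have Kp: "\<forall>w c. (w, c) \<in> ?K \<longrightarrow> c \<le> p w" using le by auto
  obtain r where r: "sublinear r" "r \<le> p" "\<forall>w c. (w, c) \<in> ?K \<longrightarrow> r (- w) \<le> - c"
    using sublinear_below_cone[OF p K Kp] by (elim exE conjE) (rule that)
  obtain f where f: "sublinear f" "f \<le> r" "\<And>r. sublinear r \<Longrightarrow> r \<le> f \<Longrightarrow> r = f"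
    using minimal_sublinear[OF r(1)] by blast
  have lin: "linear f" by (rule minimal_sublinear_linear[OF f(1,3)])
  show ?thesis
  proof (rule that[OF lin])
    show "f \<le> p" using f(2) r(2) by (rule order_trans)
    fix i assume "i \<in> I"
    then have "(v i, b i) \<in> ?K" using mem[of "{i}" "\<lambda>_. 1"] by simp
    with r(3) have "r (- v i) \<le> - b i" by blast
    then show "b i \<le> f (v i)" using le_funD[OF f(2), of "- v i"] linear_neg[OF lin, of "v i"] by simp
  qed
qed


section \<open>Sparse sets of full measure\<close>

lemma finitely_additive_Un:
  "finitely_additive \<mu> \<Longrightarrow> A \<inter> B = {} \<Longrightarrow> \<mu> (A \<union> B) = \<mu> A + \<mu> B"
  by (simp add: finitely_additive_def)

lemma finitely_additive_mono:
  assumes "finitely_additive \<mu>" "\<And>A. 0 \<le> \<mu> A" "A \<subseteq> B"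
  shows "\<mu> A \<le> \<mu> B"
proof -
  have "\<mu> (A \<union> (B - A)) = \<mu> A + \<mu> (B - A)"
    by (rule finitely_additive_Un[OF assms(1)]) blast
  moreover have "A \<union> (B - A) = B" using assms(3) by blast
  ultimately show ?thesis using assms(2)[of "B - A"] by simp
qed

text \<open>The complement of \<open>B\<close> has measure at most 0, so by monotonicity removing it
  from \<open>A\<close> loses nothing.\<close>

lemma finitely_additive_full_Int:
  assumes fa: "finitely_additive \<mu>" and nonneg: "\<And>A. 0 \<le> \<mu> A"
    and full: "\<mu> UNIV \<le> \<mu> A" "\<mu> UNIV \<le> \<mu> B"
  shows "\<mu> UNIV \<le> \<mu> (A \<inter> B)"
proof -
  have split: "\<mu> (C \<inter> B) + \<mu> (C \<inter> - B) = \<mu> C" for C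
  proof -
    have "\<mu> ((C \<inter> B) \<union> (C \<inter> - B)) = \<mu> (C \<inter> B) + \<mu> (C \<inter> - B)"
      by (rule finitely_additive_Un[OF fa]) blast
    moreover have "(C \<inter> B) \<union> (C \<inter> - B) = C" by blast
    ultimately show ?thesis by simp
  qed
  have "\<mu> (A \<inter> - B) \<le> \<mu> (- B)" by (rule finitely_additive_mono[OF fa nonneg]) simp
  with split[of A] split[of UNIV] full show ?thesis by simp
qed

text \<open>The fibres of a finite-to-one map form a partition into finite sets; meeting each fibre
  at most once means injectivity.\<close>

lemma strong_Q_measure_inj_on:
  fixes b :: "nat \<Rightarrow> nat"
  assumes "strong_Q_measure \<mu>" and fin: "\<And>k. finite (b -` {k})"
  obtains A where "\<mu> UNIV \<le> \<mu> A" "inj_on b A"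
proof -
  let ?P = "(\<lambda>k. b -` {k}) ` range b"
  have "partition_on UNIV ?P" by (rule partition_onI) (auto simp: disjnt_def)
  then obtain A where A: "\<mu> UNIV \<le> \<mu> A" "\<forall>p\<in>?P. card (A \<inter> p) \<le> 1"
    using assms unfolding strong_Q_measure_def by blast
  have "inj_on b A"
  proof (rule inj_onI)
    fix m n assume mn: "m \<in> A" "n \<in> A" "b m = b n"
    have "card (A \<inter> b -` {b m}) \<le> 1" using A(2) by blast
    \<comment> \<open>Finiteness of the fibre matters here, since \<open>card\<close> of an infinite
      set is 0.\<close>
    then show "m = n" using fin[of "b m"] mn by (auto simp: card_le_Suc0_iff_eq)
  qed
  with A(1) that show ?thesis by blast
qed

text \<open>Choosing one point from each interval of a partition may still choose neighbouring points of
  adjacent intervals. Pairing the intervals in the two possible ways and intersecting the two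
  resulting selectors leaves a whole interval between any two chosen points.\<close>

lemma strong_Q_measure_sparse:
  fixes g :: "nat \<Rightarrow> nat"
  assumes Q: "strong_Q_measure \<mu>" and nonneg: "\<And>A. 0 \<le> \<mu> A"
  obtains A where "\<mu> UNIV \<le> \<mu> A" "\<And>m. m \<in> A \<Longrightarrow> \<exists>k\<le>m. g k \<le> m \<and> A \<inter> {..<m} \<subseteq> {..<k}"
proof -
  \<comment> \<open>Endpoints of the intervals: the next one lies beyond \<open>g\<close> of the
    current one, so every point separated from \<open>p k\<close> by a whole interval is at least
    \<open>g (p k)\<close>.\<close>
  define p where "p = rec_nat 0 (\<lambda>_ n. max (g n) (Suc n))"
  have p0: "p 0 = 0" and pSuc: "p (Suc k) = max (g (p k)) (Suc (p k))" for k
    by (simp_all add: p_def)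
  have "strict_mono p" by (rule strict_monoI_Suc) (simp add: pSuc)
  then have p_mono: "p j \<le> p k" if "j \<le> k" for j k
    using that by (simp add: strict_mono_less_eq)
  \<comment> \<open>The index of the interval from \<open>p k\<close> to below
    \<open>p (Suc k)\<close> that contains \<open>m\<close>.\<close>
  define b where "b m = (LEAST k. m < p (Suc k))" for m
  have upper: "m < p (Suc (b m))" for m
    unfolding b_def using strict_mono_imp_increasing[OF \<open>strict_mono p\<close>, of "Suc m"]
    by (intro LeastI[of "\<lambda>k. m < p (Suc k)" m]) simp
  have lower: "p (b m) \<le> m" for m
  proof (cases "b m")
    case (Suc j)
    then show ?thesis using not_less_Least[of j "\<lambda>k. m < p (Suc k)"] by (simp add: b_def[symmetric])
  qed (simp add: p0)
  have b_mono: "b n \<le> b m" if "n < m" for m n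
    unfolding b_def[of n] using upper[of m] that by (intro Least_le) simp
  have fin: "finite {m. b m \<le> j}" for j
  proof (rule finite_subset)
    show "{m. b m \<le> j} \<subseteq> {..<p (Suc j)}"
      using upper p_mono by (auto intro: less_le_trans[OF upper])
  qed simp
  \<comment> \<open>The two pairings join the intervals \<open>2 * k\<close> and
    \<open>2 * k + 1\<close>, respectively \<open>2 * k - 1\<close> and \<open>2 * k\<close>, with
    interval 0 alone in the second.\<close>
  have fin1: "finite ((\<lambda>m. b m div 2) -` {k})" for k
    by (rule finite_subset[OF _ fin[of "2 * k + 1"]]) auto
  have fin2: "finite ((\<lambda>m. Suc (b m) div 2) -` {k})" for k
    by (rule finite_subset[OF _ fin[of "2 * k + 1"]]) auto
  obtain A1 where A1: "\<mu> UNIV \<le> \<mu> A1" "inj_on (\<lambda>m. b m div 2) A1"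
    by (rule strong_Q_measure_inj_on[OF Q fin1])
  obtain A2 where A2: "\<mu> UNIV \<le> \<mu> A2" "inj_on (\<lambda>m. Suc (b m) div 2) A2"
    by (rule strong_Q_measure_inj_on[OF Q fin2])
  have fa: "finitely_additive \<mu>" and null: "\<And>A. finite A \<Longrightarrow> \<mu> A = 0"
    using Q by (auto simp: strong_Q_measure_def fa_measure_def)
  \<comment> \<open>Interval 0 has no predecessor to serve as a gap; being finite, it can be
    discarded.\<close>
  have "\<mu> ({..<p 1} \<union> {p 1..}) = \<mu> {..<p 1} + \<mu> {p 1..}"
    by (rule finitely_additive_Un[OF fa]) auto
  moreover have "{..<p 1} \<union> {p 1..} = UNIV" by auto
  ultimately have "\<mu> UNIV \<le> \<mu> {p 1..}" using null[of "{..<p 1}"] by simp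
  then have "\<mu> UNIV \<le> \<mu> (A1 \<inter> A2 \<inter> {p 1..})"
    by (intro finitely_additive_full_Int[OF fa nonneg] A1 A2)
  moreover have "\<exists>k\<le>m. g k \<le> m \<and> (A1 \<inter> A2 \<inter> {p 1..}) \<inter> {..<m} \<subseteq> {..<k}"
    if m: "m \<in> A1 \<inter> A2 \<inter> {p 1..}" for m
  proof -
    have "b m \<noteq> 0" using upper[of m] m by (intro notI) simp
    then obtain j where j: "b m = Suc j" by (cases "b m") auto
    have "p j \<le> m" "g (p j) \<le> m" using lower[of m] by (simp_all add: j pSuc)
    moreover have "n < p j" if n: "n \<in> A1 \<inter> A2" "n < m" for n
    proof -
      have "b n div 2 \<noteq> b m div 2" using A1(2) n m by (auto dest: inj_onD)
      moreover have "Suc (b n) div 2 \<noteq> Suc (b m) div 2" using A2(2) n m by (auto dest: inj_onD)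
      \<comment> \<open>The intervals \<open>j\<close> and \<open>Suc j\<close> are paired by
        \<open>div 2\<close> of the index if \<open>j\<close> is even, and by the shifted pairing if
        \<open>j\<close> is odd. So \<open>n\<close> lies before interval \<open>j\<close>, and
        \<open>p j\<close> is the required witness.\<close>
      ultimately have "b n \<noteq> Suc j" "b n \<noteq> j" unfolding j by (auto elim: evenE oddE)
      with b_mono[OF n(2)] j have "Suc (b n) \<le> j" by simp
      from upper[of n] p_mono[OF this] show ?thesis by (rule less_le_trans)
    qed
    ultimately show ?thesis by blast
  qed
  ultimately show ?thesis by (rule that)
qed


section \<open>Almost isometric copies of the positive cone of the summable sequences\<close>

text \<open>Convergence at the finitely many points of a \<open>d / 3\<close>-net suffices: moving
  from \<open>v\<close> to a net point changes each of the two norms by less than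
  \<open>d / 3\<close>.\<close>

lemma L_orthogonal_seq_uniform_compact:
  assumes x: "L_orthogonal_seq x" and S: "compact S" and d: "0 < d"
  shows "\<forall>\<^sub>F m in sequentially. \<forall>v\<in>S. 1 + norm v - d \<le> norm (v + x m)"
proof -
  obtain N where N: "finite N" "S \<subseteq> (\<Union>u\<in>N. ball u (d / 3))"
    using S d unfolding compact_eq_totally_bounded by (meson divide_pos_pos zero_less_numeral)
  have "\<forall>\<^sub>F m in sequentially. 1 + norm u - d / 3 < norm (u + x m)" for u
    using x d unfolding L_orthogonal_seq_def
    by (intro order_tendstoD(1)[of _ "1 + norm u"]) simp_all
  then have "\<forall>\<^sub>F m in sequentially. \<forall>u\<in>N. 1 + norm u - d / 3 < norm (u + x m)"
    using N(1) by (simp add: eventually_ball_finite_distrib)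
  then show ?thesis
  proof (eventually_elim, intro ballI)
    fix m v assume m: "\<forall>u\<in>N. 1 + norm u - d / 3 < norm (u + x m)" and "v \<in> S"
    then obtain u where u: "u \<in> N" "norm (u - v) < d / 3"
      using N(2) by (auto simp: dist_norm)
    have "norm (u + x m) \<le> norm (v + x m) + norm (u - v)"
      using norm_triangle_ineq[of "v + x m" "u - v"] by (simp add: algebra_simps)
    moreover have "norm v \<le> norm u + norm (u - v)"
      using norm_triangle_ineq4[of u "u - v"] by simp
    ultimately show "1 + norm v - d \<le> norm (v + x m)" using m u by fastforce
  qed
qed

text \<open>Scale \<open>v + x\<close> by the larger of \<open>s\<close> and \<open>a\<close>, then
  remove the surplus multiple of \<open>x\<close> or of \<open>v\<close> by the triangle inequality.
  The error is \<open>d\<close> times the larger coefficient, hence at most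
  \<open>d * (s + a)\<close>.\<close>

lemma norm_add_scaleR_ge:
  fixes v x :: "'a::real_normed_vector"
  assumes vx: "1 + norm v - d \<le> norm (v + x)" and x: "norm x \<le> 1"
    and nonneg: "0 \<le> s" "0 \<le> a" "0 \<le> d"
  shows "norm (s *\<^sub>R v) + a - d * (s + a) \<le> norm (s *\<^sub>R v + a *\<^sub>R x)"
proof (cases "a \<le> s")
  case True
  have "norm (s *\<^sub>R (v + x)) \<le> norm (s *\<^sub>R v + a *\<^sub>R x) + norm ((s - a) *\<^sub>R x)"
    using norm_triangle_ineq[of "s *\<^sub>R v + a *\<^sub>R x" "(s - a) *\<^sub>R x"] by (simp add: algebra_simps)
  moreover have "norm ((s - a) *\<^sub>R x) \<le> s - a" using True x by (simp add: mult_left_le)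
  moreover have "s + s * norm v - d * s \<le> norm (s *\<^sub>R (v + x))"
    using mult_left_mono[OF vx nonneg(1)] nonneg unfolding norm_scaleR by (simp add: algebra_simps)
  moreover have "0 \<le> d * a" "norm (s *\<^sub>R v) = s * norm v" using nonneg by simp_all
  ultimately show ?thesis unfolding distrib_left by linarith
next
  case False
  have "norm (a *\<^sub>R (v + x)) \<le> norm (s *\<^sub>R v + a *\<^sub>R x) + norm ((a - s) *\<^sub>R v)"
    using norm_triangle_ineq[of "s *\<^sub>R v + a *\<^sub>R x" "(a - s) *\<^sub>R v"] by (simp add: algebra_simps)
  moreover have "norm ((a - s) *\<^sub>R v) = a * norm v - s * norm v" using False by (simp add: left_diff_distrib)
  moreover have "a + a * norm v - d * a \<le> norm (a *\<^sub>R (v + x))"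
    using mult_left_mono[OF vx nonneg(2)] nonneg unfolding norm_scaleR by (simp add: algebra_simps)
  moreover have "0 \<le> d * s" "norm (s *\<^sub>R v) = s * norm v" using nonneg by simp_all
  ultimately show ?thesis unfolding distrib_left by linarith
qed

text \<open>Divide by the total weight. Using the hull over \<open>E\<close> rather than
  \<open>D\<close> gives one set, compact for finite \<open>E\<close>, that serves every
  \<open>D\<close>.\<close>

lemma nonneg_combination_in_cone_convex_hull:
  fixes x :: "nat \<Rightarrow> 'a::real_vector"
  assumes "0 \<le> t" "\<And>i. 0 \<le> a i" "finite D" "D \<subseteq> E"
  shows "\<exists>v\<in>convex hull (insert y (x ` E)). t *\<^sub>R y + (\<Sum>i\<in>D. a i *\<^sub>R x i) = (t + sum a D) *\<^sub>R v"
proof -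
  let ?s = "t + sum a D" and ?C = "convex hull (insert y (x ` E))"
  have x: "x i \<in> ?C" if "i \<in> D" for i
    using that assms(4) by (auto intro: hull_inc)
  have y: "y \<in> ?C" by (auto intro: hull_inc)
  show ?thesis
  proof (cases "?s = 0")
    case True
    then have "t = 0" "sum a D = 0" using assms sum_nonneg[of D a] by force+
    then have "\<forall>i\<in>D. a i = 0" using assms by (simp add: sum_nonneg_eq_0_iff)
    with True \<open>t = 0\<close> y show ?thesis by (intro bexI[of _ y]) simp_all
  next
    case False
    then have s: "?s > 0" using assms sum_nonneg[of D a] by (smt (verit))
    let ?v = "(t / ?s) *\<^sub>R y + (\<Sum>i\<in>D. (a i / ?s) *\<^sub>R x i)"
    \<comment> \<open>The index \<open>None\<close> carries \<open>y\<close> and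
      \<open>Some i\<close> carries \<open>x i\<close>, so that one indexed convex sum covers
      both.\<close>
    let ?I = "insert None (Some ` D)"
    have "(\<Sum>i\<in>?I. (case i of None \<Rightarrow> t / ?s | Some i \<Rightarrow> a i / ?s) *\<^sub>R (case i of None \<Rightarrow> y | Some i \<Rightarrow> x i)) \<in> ?C"
      by (rule convex_sum)
        (use assms s y x in \<open>auto simp: sum.reindex sum_divide_distrib[symmetric] add_divide_distrib[symmetric]\<close>)
    then have "?v \<in> ?C" using assms(3) by (simp add: sum.reindex)
    moreover have "t *\<^sub>R y + (\<Sum>i\<in>D. a i *\<^sub>R x i) = ?s *\<^sub>R ?v"
      using False by (simp add: scaleR_add_right scaleR_sum_right)
    ultimately show ?thesis by blast
  qed
qed

text \<open>Compactness of the hull of \<open>y\<close> and the first \<open>k\<close> terms yields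
  a single threshold \<open>g k\<close>; homogeneity extends it to the cone. Tolerances depending on
  \<open>k\<close> allow summable errors later.\<close>

lemma L_orthogonal_seq_modulus:
  assumes x: "L_orthogonal_seq x" and e: "\<And>k. 0 < e k"
  obtains g :: "nat \<Rightarrow> nat" where "\<And>k m t a c D. g k \<le> m \<Longrightarrow> 0 \<le> t \<Longrightarrow> (\<And>i. 0 \<le> a i) \<Longrightarrow> 0 \<le> c
    \<Longrightarrow> D \<subseteq> {..<k} \<Longrightarrow> norm (t *\<^sub>R y + (\<Sum>i\<in>D. a i *\<^sub>R x i)) + c - e k * (t + sum a D + c)
      \<le> norm (t *\<^sub>R y + (\<Sum>i\<in>D. a i *\<^sub>R x i) + c *\<^sub>R x m)"
proof -
  let ?S = "\<lambda>k. convex hull (insert y (x ` {..<k}))"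
  have "\<exists>N. \<forall>m\<ge>N. \<forall>v\<in>?S k. 1 + norm v - e k \<le> norm (v + x m)" for k
    using L_orthogonal_seq_uniform_compact[OF x finite_imp_compact_convex_hull e[of k], of "insert y (x ` {..<k})"]
    by (simp add: eventually_sequentially)
  then obtain g where g: "\<And>k m v. g k \<le> m \<Longrightarrow> v \<in> ?S k \<Longrightarrow> 1 + norm v - e k \<le> norm (v + x m)"
    by metis
  show ?thesis
  proof (rule that[of g])
    fix k m :: nat and t c :: real and a :: "nat \<Rightarrow> real" and D
    assume *: "g k \<le> m" "0 \<le> t" "\<And>i. 0 \<le> a i" "0 \<le> c" "D \<subseteq> {..<k}"
    from *(5) have "finite D" by (rule finite_subset) simp
    from nonneg_combination_in_cone_convex_hull[of t a D "{..<k}" y x, OF *(2,3) this *(5)]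
    obtain v where v: "v \<in> ?S k" "t *\<^sub>R y + (\<Sum>i\<in>D. a i *\<^sub>R x i) = (t + sum a D) *\<^sub>R v" by blast
    have "norm (x m) \<le> 1" using x by (simp add: L_orthogonal_seq_def)
    moreover have "0 \<le> t + sum a D" using * by (simp add: sum_nonneg)
    ultimately show "norm (t *\<^sub>R y + (\<Sum>i\<in>D. a i *\<^sub>R x i)) + c - e k * (t + sum a D + c)
      \<le> norm (t *\<^sub>R y + (\<Sum>i\<in>D. a i *\<^sub>R x i) + c *\<^sub>R x m)"
      unfolding v(2) using *(4) e[of k] by (intro norm_add_scaleR_ge[OF g[OF *(1) v(1)]]) simp_all
  qed
qed

text \<open>Add the terms in increasing order of index. Sparseness places all earlier indices below
  some \<open>k\<close> with \<open>g k \<le> m\<close>, so adding \<open>x m\<close> costs only the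
  relative error \<open>e / 2 ^ Suc k\<close>.\<close>

lemma L_orthogonal_seq_sparse_estimate:
  assumes x: "L_orthogonal_seq x" and Q: "strong_Q_measure \<mu>" and nonneg: "\<And>A. 0 \<le> \<mu> A" and e: "0 < e"
  obtains A where "\<mu> UNIV \<le> \<mu> A"
    "\<And>D t a. finite D \<Longrightarrow> D \<subseteq> A \<Longrightarrow> 0 \<le> t \<Longrightarrow> (\<And>i. 0 \<le> a i)
      \<Longrightarrow> t * (norm y - e) + (\<Sum>i\<in>D. a i * (1 - e)) \<le> norm (t *\<^sub>R y + (\<Sum>i\<in>D. a i *\<^sub>R x i))"
proof -
  obtain g :: "nat \<Rightarrow> nat" where g: "\<And>k m t a c D. g k \<le> m \<Longrightarrow> 0 \<le> t \<Longrightarrow> (\<And>i. 0 \<le> a i) \<Longrightarrow> 0 \<le> c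
    \<Longrightarrow> D \<subseteq> {..<k} \<Longrightarrow> norm (t *\<^sub>R y + (\<Sum>i\<in>D. a i *\<^sub>R x i)) + c - e / 2 ^ Suc k * (t + sum a D + c)
      \<le> norm (t *\<^sub>R y + (\<Sum>i\<in>D. a i *\<^sub>R x i) + c *\<^sub>R x m)"
    by (rule L_orthogonal_seq_modulus[OF x, of "\<lambda>k. e / 2 ^ Suc k" y]) (use e in auto)
  obtain A where A: "\<mu> UNIV \<le> \<mu> A" "\<And>m. m \<in> A \<Longrightarrow> \<exists>k\<le>m. g k \<le> m \<and> A \<inter> {..<m} \<subseteq> {..<k}"
    using strong_Q_measure_sparse[OF Q nonneg] by blast
  show ?thesis
  proof (rule that[OF A(1)])
    fix D and t :: real and a :: "nat \<Rightarrow> real"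
    assume D: "finite D" "D \<subseteq> A" and t: "0 \<le> t" and a: "\<And>i. 0 \<le> a i"
    \<comment> \<open>The factor \<open>1 - 1 / 2 ^ M\<close> is the sum of
      \<open>1 / 2 ^ Suc k\<close> over \<open>k < M\<close>; tracking it, rather than 1, leaves
      room for the next error.\<close>
    have claim: "t * norm y + sum a D - e * (1 - 1 / 2 ^ M) * (t + sum a D)
        \<le> norm (t *\<^sub>R y + (\<Sum>i\<in>D. a i *\<^sub>R x i))" if "D \<subseteq> {..<M}" for M
      using D that
    proof (induction D arbitrary: M rule: finite_linorder_max_induct)
      case empty
      have "0 \<le> e * (1 - 1 / 2 ^ M) * t" using e t by simp
      then show ?case using t by simp
    next
      case (insert m D)
      obtain k where k: "k \<le> m" "g k \<le> m" "A \<inter> {..<m} \<subseteq> {..<k}" using A(2)[of m] insert.prems by blast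
      have Dk: "D \<subseteq> {..<k}" using insert k(3) by blast
      let ?s = "t + sum a D" and ?w = "t *\<^sub>R y + (\<Sum>i\<in>D. a i *\<^sub>R x i)"
      have s: "0 \<le> ?s" using t a by (simp add: sum_nonneg)
      have "(1 - 1 / 2 ^ k) * ?s + 1 / 2 ^ Suc k * (?s + a m) \<le> (1 - 1 / 2 ^ M) * (?s + a m)"
      proof -
        have "(1 - 1 / 2 ^ k) * ?s \<le> (1 - 1 / 2 ^ k) * (?s + a m)"
          by (rule mult_left_mono) (use a[of m] in simp_all)
        \<comment> \<open>Since \<open>k \<le> m < M\<close>, the budget
          \<open>1 - 1 / 2 ^ k\<close> of the induction hypothesis, taken at \<open>k\<close>, plus
          the new error is \<open>1 - 1 / 2 ^ Suc k\<close>, within the budget for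
          \<open>M\<close>.\<close>
        moreover have "(1 / 2 ^ M :: real) \<le> 1 / 2 ^ Suc k"
          using k(1) insert.prems by (intro divide_left_mono power_increasing) auto
        then have "((1 - 1 / 2 ^ k) + 1 / 2 ^ Suc k) * (?s + a m) \<le> (1 - 1 / 2 ^ M) * (?s + a m)"
          using s a[of m] by (intro mult_right_mono) simp_all
        ultimately show ?thesis by (simp only: distrib_right)
      qed
      from mult_left_mono[OF this, of e]
      have err: "e * (1 - 1 / 2 ^ k) * ?s + e / 2 ^ Suc k * (?s + a m) \<le> e * (1 - 1 / 2 ^ M) * (?s + a m)"
        using e by (simp add: distrib_left mult.assoc)
      have "t * norm y + sum a D - e * (1 - 1 / 2 ^ k) * ?s \<le> norm ?w"
        by (rule insert.IH) (use insert.prems Dk in auto)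
      moreover have "norm ?w + a m - e / 2 ^ Suc k * (?s + a m) \<le> norm (?w + a m *\<^sub>R x m)"
        by (rule g[OF k(2) t a a Dk])
      ultimately have "t * norm y + (sum a D + a m) - e * (1 - 1 / 2 ^ M) * (?s + a m)
          \<le> norm (?w + a m *\<^sub>R x m)"
        using err by linarith
      moreover have "m \<notin> D" using insert.hyps by blast
      ultimately show ?case using insert.hyps(1) by (simp add: add_ac)
    qed
    obtain M where "D \<subseteq> {..<M}" using finite_nat_iff_bounded D(1) by blast
    note claim[OF this]
    moreover have "e * (1 - 1 / 2 ^ M) * (t + sum a D) \<le> e * (t + sum a D)"
      using e t a by (intro mult_right_mono) (simp_all add: sum_nonneg)
    ultimately show "t * (norm y - e) + (\<Sum>i\<in>D. a i * (1 - e)) \<le> norm (t *\<^sub>R y + (\<Sum>i\<in>D. a i *\<^sub>R x i))"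
      unfolding sum_distrib_right[symmetric] by (simp add: algebra_simps)
  qed
qed

text \<open>The bound at \<open>y\<close> is first built into \<open>q\<close>, by lowering the norm
  along \<open>y\<close>. The sparse estimate is then exactly the Mazur--Orlicz hypothesis for
  \<open>q\<close> and the points \<open>x n\<close>.\<close>

lemma L_orthogonal_seq_norming_functional:
  fixes x :: "nat \<Rightarrow> 'a::real_normed_vector"
  assumes "L_orthogonal_seq x" "strong_Q_measure \<mu>" "\<And>A. 0 \<le> \<mu> A" and e: "0 < e"
  obtains f :: "'a dual" and A where "norm f \<le> 1" "\<mu> UNIV \<le> \<mu> A"
    "norm y - e \<le> blinfun_apply f y" "\<And>n. n \<in> A \<Longrightarrow> 1 - e \<le> blinfun_apply f (x n)"
proof -
  obtain A where A: "\<mu> UNIV \<le> \<mu> A"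
    and est: "\<And>D t a. finite D \<Longrightarrow> D \<subseteq> A \<Longrightarrow> 0 \<le> t \<Longrightarrow> (\<And>i. 0 \<le> a i)
      \<Longrightarrow> t * (norm y - e) + (\<Sum>i\<in>D. a i * (1 - e)) \<le> norm (t *\<^sub>R y + (\<Sum>i\<in>D. a i *\<^sub>R x i))"
    using L_orthogonal_seq_sparse_estimate[OF assms, where y = y] by blast
  have "norm y - e \<le> norm y" using e by simp
  from sublinear_below_direction[OF sublinear_norm this]
  obtain q where q: "sublinear q" "q \<le> norm" "q (- y) \<le> - (norm y - e)"
    "\<forall>v d. (\<forall>t\<ge>0. d \<le> norm (v + t *\<^sub>R y) - t * (norm y - e)) \<longrightarrow> d \<le> q v" by blast
  have "(\<Sum>i\<in>D. a i * (1 - e)) \<le> q (\<Sum>i\<in>D. a i *\<^sub>R x i)"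
    if "finite D" "D \<subseteq> A" "\<And>i. 0 \<le> a i" for D and a :: "nat \<Rightarrow> real"
  proof (rule q(4)[rule_format])
    fix t :: real assume "0 \<le> t"
    then show "(\<Sum>i\<in>D. a i * (1 - e)) \<le> norm ((\<Sum>i\<in>D. a i *\<^sub>R x i) + t *\<^sub>R y) - t * (norm y - e)"
      using est[of D t a] that by (simp add: add.commute)
  qed
  from Mazur_Orlicz[OF q(1) this] obtain f where f: "linear f" "f \<le> q" "\<And>n. n \<in> A \<Longrightarrow> 1 - e \<le> f (x n)"
    by blast
  have le: "f v \<le> norm v" for v using le_funD[OF f(2), of v] le_funD[OF q(2), of v] by linarith
  have abs_le: "norm (f v) \<le> norm v * 1" for v
    using le[of v] le[of "- v"] linear_neg[OF f(1), of v] by simp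
  have bl: "bounded_linear f"
    by (rule bounded_linear_intro[OF linear_add[OF f(1)] linear_scale[OF f(1)] abs_le])
  show ?thesis
  proof (rule that[of "Blinfun f", OF _ A])
    show "norm (Blinfun f) \<le> 1"
      by (rule norm_blinfun_bound) (use abs_le in \<open>simp_all add: bounded_linear_Blinfun_apply[OF bl]\<close>)
    show "norm y - e \<le> blinfun_apply (Blinfun f) y"
      using le_funD[OF f(2), of "- y"] q(3) linear_neg[OF f(1), of y]
      by (simp add: bounded_linear_Blinfun_apply[OF bl])
    show "1 - e \<le> blinfun_apply (Blinfun f) (x n)" if "n \<in> A" for n
      using f(3)[OF that] by (simp add: bounded_linear_Blinfun_apply[OF bl])
  qed
qed


section \<open>The limit along the measure\<close>

text \<open>For a nonnegative measure the variation over any finite partition is the total mass. The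
  functional built with this norm bound is \<open>ba_functional \<mu>\<close> by uniqueness.\<close>

lemma norm_ba_functional_le:
  assumes fa: "finitely_additive \<mu>" and nonneg: "\<And>A. 0 \<le> \<mu> A"
  shows "norm (ba_functional \<mu>) \<le> \<mu> UNIV"
proof -
  have "(\<Sum>A\<in>P. \<bar>\<mu> A\<bar>) \<le> \<mu> UNIV" if "finite P" "partition_on UNIV P" for P
    using that finitely_additive_UN[OF fa, of P "\<lambda>A. A"] nonneg
    by (simp add: partition_on_def disjoint_family_on_def disjoint_def)
  from ba_functional_exists[OF fa this] obtain \<phi> :: "l1 dual dual"
    where \<phi>: "\<forall>A. blinfun_apply \<phi> (linf_dual (indicator A)) = \<mu> A" "norm \<phi> \<le> \<mu> UNIV" by blast
  have "ba_functional \<mu> = \<phi>"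
    using \<phi>(1) ba_functional[OF fa bounded_variation_nonneg[OF fa nonneg]]
    by (intro ba_functional_unique) simp
  with \<phi>(2) show ?thesis by simp
qed

text \<open>The function \<open>2 * indicator A - f\<close> has supremum norm at most \<open>1 + e\<close>.\<close>

lemma ba_functional_ge:
  assumes fa: "finitely_additive \<mu>" and nonneg: "\<And>A. 0 \<le> \<mu> A" and one: "\<mu> UNIV = 1"
    and A: "1 \<le> \<mu> A" and e: "0 \<le> e" and f: "\<And>n. \<bar>f n\<bar> \<le> 1" "\<And>n. n \<in> A \<Longrightarrow> 1 - e \<le> f n"
  shows "1 - e \<le> blinfun_apply (ba_functional \<mu>) (linf_dual f)"
proof -
  let ?h = "\<lambda>n. 2 * indicator A n + (- 1) * f n :: real"
  \<comment> \<open>On \<open>A\<close> the value \<open>2 - f n\<close> lies between 1 and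
    \<open>1 + e\<close>; elsewhere it is \<open>- f n\<close>.\<close>
  have h: "norm (?h n) \<le> 1 + e" for n
    using f(1)[of n] f(2)[of n] e by (auto simp: indicator_def abs_le_iff)
  have "linf_dual ?h = 2 *\<^sub>R linf_dual (indicator A) + (- 1) *\<^sub>R linf_dual f"
    by (rule linf_dual_bounded_linear_combination[of _ 1 _ 1]) (use f in \<open>simp_all add: indicator_def\<close>)
  then have "2 * \<mu> A - blinfun_apply (ba_functional \<mu>) (linf_dual f)
      = blinfun_apply (ba_functional \<mu>) (linf_dual ?h)"
    using ba_functional[OF fa bounded_variation_nonneg[OF fa nonneg]]
    by (simp add: blinfun.diff_right blinfun.scaleR_right)
  also have "\<dots> \<le> norm (ba_functional \<mu>) * norm (linf_dual ?h)"
    using norm_blinfun[of "ba_functional \<mu>" "linf_dual ?h"] by simp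
  also have "\<dots> \<le> 1 * (1 + e)"
    using norm_ba_functional_le[OF fa nonneg] one l1_operator(2)[OF h] by (intro mult_mono) simp_all
  finally show ?thesis using A by simp
qed

lemma mu_lim_apply:
  "blinfun_apply (mu_lim \<mu> x) f = blinfun_apply (ba_functional \<mu>) (f o\<^sub>L l1_operator x)"
  by (simp add: mu_lim_def dual_map_apply)

theorem theorem4p3:
  fixes x :: "nat \<Rightarrow> 'a::banach" and \<mu> :: "nat set \<Rightarrow> real"
  assumes "L_orthogonal_seq x"
    and "strong_Q_measure \<mu>"
    and "\<And>A. \<mu> A \<in> {0..1}"
    and "\<mu> UNIV = 1"
  shows "L_orthogonal_bidual (mu_lim \<mu> x)"
  unfolding L_orthogonal_bidual_def
proof
  fix y
  have nonneg: "\<And>A. 0 \<le> \<mu> A" using assms(3) by simp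
  have fa: "finitely_additive \<mu>" using assms(2) by (simp add: strong_Q_measure_def fa_measure_def)
  have x: "norm (x n) \<le> 1" for n using assms(1) by (simp add: L_orthogonal_seq_def)
  show "norm (bidual_embed y + mu_lim \<mu> x) = 1 + norm y"
  proof (rule antisym)
    have "norm (bidual_embed y) \<le> norm y"
    proof (rule norm_blinfun_bound)
      show "norm (blinfun_apply (bidual_embed y) f) \<le> norm y * norm f" for f
        using norm_blinfun[of f y] by (simp add: bidual_embed_apply mult.commute)
    qed simp
    moreover have "norm (mu_lim \<mu> x) \<le> 1"
    proof (rule norm_blinfun_bound)
      fix f :: "'a dual"
      have "norm (blinfun_apply (mu_lim \<mu> x) f) \<le> norm (ba_functional \<mu>) * norm (f o\<^sub>L l1_operator x)"
        unfolding mu_lim_apply by (rule norm_blinfun)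
      also have "\<dots> \<le> 1 * (norm f * 1)"
      proof (intro mult_mono)
        have "norm (f o\<^sub>L l1_operator x) \<le> norm f * norm (l1_operator x)"
          by (rule norm_blinfun_compose)
        also have "\<dots> \<le> norm f * 1" by (intro mult_left_mono l1_operator(2) x) simp
        finally show "norm (f o\<^sub>L l1_operator x) \<le> norm f * 1" .
      qed (use norm_ba_functional_le[OF fa nonneg] assms(4) in simp_all)
      finally show "norm (blinfun_apply (mu_lim \<mu> x) f) \<le> 1 * norm f" by simp
    qed simp
    ultimately show "norm (bidual_embed y + mu_lim \<mu> x) \<le> 1 + norm y"
      using norm_triangle_ineq[of "bidual_embed y" "mu_lim \<mu> x"] by linarith
  next
    show "1 + norm y \<le> norm (bidual_embed y + mu_lim \<mu> x)"
    proof (rule field_le_epsilon)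
      fix d :: real assume "0 < d"
      \<comment> \<open>One half is lost at \<open>y\<close>, the other in the limit along the
        measure.\<close>
      then have e: "0 < d / 2" by simp
      obtain f :: "'a dual" and A where f: "norm f \<le> 1" "\<mu> UNIV \<le> \<mu> A"
        "norm y - d / 2 \<le> blinfun_apply f y" "\<And>n. n \<in> A \<Longrightarrow> 1 - d / 2 \<le> blinfun_apply f (x n)"
        using L_orthogonal_seq_norming_functional[OF assms(1,2) nonneg e, of y] by blast
      have "\<bar>blinfun_apply f (x n)\<bar> \<le> 1" for n
        using norm_blinfun[of f "x n"] mult_mono[OF f(1) x[of n]] by simp
      then have "1 - d / 2 \<le> blinfun_apply (ba_functional \<mu>) (linf_dual (\<lambda>n. blinfun_apply f (x n)))"
        using f(2,4) e assms(4) by (intro ba_functional_ge[OF fa nonneg assms(4), of A]) simp_all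
      \<comment> \<open>Composing \<open>f\<close> with the operator gives the functional on
        \<open>l1\<close> with coefficients \<open>f (x n)\<close>, which links the second adjoint
        to the measure.\<close>
      also have "linf_dual (\<lambda>n. blinfun_apply f (x n)) = f o\<^sub>L l1_operator x"
        using linf_dual_coeffs[of "f o\<^sub>L l1_operator x"] l1_operator(1)[of x 1, OF x] by simp
      finally have "1 - d / 2 \<le> blinfun_apply (mu_lim \<mu> x) f" by (simp add: mu_lim_apply)
      then have "1 + norm y - d \<le> blinfun_apply (bidual_embed y + mu_lim \<mu> x) f"
        using f(3) by (simp add: blinfun.add_left bidual_embed_apply)
      also have "\<dots> \<le> norm (bidual_embed y + mu_lim \<mu> x) * norm f"
        using norm_blinfun[of "bidual_embed y + mu_lim \<mu> x" f] by simp
      also have "\<dots> \<le> norm (bidual_embed y + mu_lim \<mu> x)"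
        using f(1) by (simp add: mult_left_le)
      finally show "1 + norm y \<le> norm (bidual_embed y + mu_lim \<mu> x) + d" by simp
    qed
  qed
qed

end
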